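(* Fix $k\in\mathbb Z_{\ge0}$ and an irreducible fraction $t\in(0,1)$. Then the value of the regular continued fraction $F^+(k,t)$ equals $\dfrac{m_{k,t}}{u^+_{k,t}}$.
   Context: Fix $k\in\mathbb Z_{\ge0}$. Farey tree $\mathrm{F}\mathbb T$: root $\left(\frac01,\frac11,\frac10\right)$; vertex $\left(\frac ab,\frac cd,\frac ef\right)$ has left child $\left(\frac ab,\frac{a+c}{b+d},\frac cd\right)$ and right child $\left(\frac cd,\frac{c+e}{d+f},\frac ef\right)$. $\mathrm{M}\mathbb T(k)$: root $(1,k+2,1)$; vertex $(a,b,c)$ has left child $\left(a,\frac{a^2+kab+b^2}{c},b\right)$ and right child $\left(b,\frac{b^2+kbc+c^2}{a},c\right)$. Let $\theta\colon\mathrm{F}\mathbb T\to\mathrm{M}\mathbb T(k)$ be the bijection preserving root and left/right children. For irreducible $t\in(0,1)$ let $(r,t,s)$ be the vertex of $\mathrm{F}\mathbb T$ with middle entry $t$, $(m_r,m_t,m_s)=\theta(r,t,s)$, $m_{k,t}:=m_t$, and let $u^+_{k,t}$ be the unique $x\in(0,m_t)$ with $m_rx\equiv m_s\pmod{m_t}$. Construction of $F^+(k,t)$ for an irreducible fraction $t=a/b$ ($a,b\ge1$): let $L_t$ be the segment from $(0,0)$ to $(b,a)$, oriented left to right. The pre-snake graph is the union of the closed unit lattice squares whose interiors meet $L_t$, each split by its upper-left-to-lower-right diagonal into two right triangles; edges are square sides and these diagonals. Signs: each triangle gets one sign, $-$ if it is the first triangle met by $L_t$ or if its part lying above the line through $L_t$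 is a quadrilateral, else $+$; each edge meeting the interior of $L_t$ gets $k$ copies of one sign, $-$ if its midpoint lies on or above the line through $L_t$, $+$ if strictly below. Listing the signs in the order $L_t$ passes through triangles and edges, and letting $a_1,\dots,a_\ell$ be the lengths of the successive maximal blocks of equal signs, $F^+(k,t)$ is the regular continued fraction $[a_1,\dots,a_\ell]=a_1+\cfrac1{a_2+\cfrac1{\ddots+\cfrac1{a_\ell}}}$. *)

theory Defs
  imports "HOL-Analysis.Analysis" "HOL-Number_Theory.Cong"
begin

text \<open>A fraction is a pair (numerator, denominator), so that 1/0 is admitted.\<close>

type_synonym fraction = "nat \<times> nat"

datatype direction = L_child | R_child

definition mediant :: "fraction \<Rightarrow> fraction \<Rightarrow> fraction" where
  "mediant x y = (fst x + fst y, snd x + snd y)"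

definition farey_root :: "fraction \<times> fraction \<times> fraction" where
  "farey_root = ((0, 1), (1, 1), (1, 0))"

fun farey_child :: "direction \<Rightarrow> fraction \<times> fraction \<times> fraction \<Rightarrow> fraction \<times> fraction \<times> fraction" where
  "farey_child L_child (x, y, z) = (x, mediant x y, y)"
| "farey_child R_child (x, y, z) = (y, mediant y z, z)"

text \<open>A word of directions is the address of a vertex; its first letter is the first step from the root.\<close>

definition farey_vertex :: "direction list \<Rightarrow> fraction \<times> fraction \<times> fraction" where
  "farey_vertex w = fold farey_child w farey_root"

definition farey_tree :: "(fraction \<times> fraction \<times> fraction) set" where
  "farey_tree = range farey_vertex"

definition markov_root :: "nat \<Rightarrow> nat \<times> nat \<times> nat" where
  "markov_root k = (1, k + 2, 1)"

text \<open>The divisions are exact on the tree, see \<open>markov_vertex_exact\<close>.\<close>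

fun markov_child :: "nat \<Rightarrow> direction \<Rightarrow> nat \<times> nat \<times> nat \<Rightarrow> nat \<times> nat \<times> nat" where
  "markov_child k L_child (a, b, c) = (a, (a\<^sup>2 + k * a * b + b\<^sup>2) div c, b)"
| "markov_child k R_child (a, b, c) = (b, (b\<^sup>2 + k * b * c + c\<^sup>2) div a, c)"

definition markov_vertex :: "nat \<Rightarrow> direction list \<Rightarrow> nat \<times> nat \<times> nat" where
  "markov_vertex k w = fold (markov_child k) w (markov_root k)"

text \<open>The map sending a vertex of the Farey tree to the vertex with the same address.\<close>

definition theta :: "nat \<Rightarrow> fraction \<times> fraction \<times> fraction \<Rightarrow> nat \<times> nat \<times> nat" where
  "theta k v = markov_vertex k (THE w. farey_vertex w = v)"

definition farey_triple :: "fraction \<Rightarrow> fraction \<times> fraction \<times> fraction" where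
  "farey_triple t = (THE v. v \<in> farey_tree \<and> fst (snd v) = t)"

definition markov_number :: "nat \<Rightarrow> fraction \<Rightarrow> nat" where
  "markov_number k t = (case theta k (farey_triple t) of (m\<^sub>r, m\<^sub>t, m\<^sub>s) \<Rightarrow> m\<^sub>t)"

definition u_plus :: "nat \<Rightarrow> fraction \<Rightarrow> nat" where
  "u_plus k t = (case theta k (farey_triple t) of (m\<^sub>r, m\<^sub>t, m\<^sub>s) \<Rightarrow>
     (THE x. 0 < x \<and> x < m\<^sub>t \<and> [m\<^sub>r * x = m\<^sub>s] (mod m\<^sub>t)))"

lemma markov_equation_exact:
  fixes a b c k :: nat
  assumes eq: "a\<^sup>2 + b\<^sup>2 + c\<^sup>2 + k * (a * b + b * c + c * a) = (3 + 3 * k) * a * b * c"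
  shows "c dvd a\<^sup>2 + k * a * b + b\<^sup>2"
proof -
  have "int c * ((3 + 3 * int k) * int a * int b - int k * (int a + int b) - int c)
      = (int a)\<^sup>2 + int k * int a * int b + (int b)\<^sup>2"
    using arg_cong[OF eq, of int] by (simp add: algebra_simps power2_eq_square)
  then have "int c dvd int (a\<^sup>2 + k * a * b + b\<^sup>2)"
    by (metis dvd_triv_left of_nat_add of_nat_mult of_nat_power)
  then show ?thesis
    by (simp only: int_dvd_int_iff)
qed

lemma markov_equation_step:
  fixes a b c k :: nat
  assumes eq: "a\<^sup>2 + b\<^sup>2 + c\<^sup>2 + k * (a * b + b * c + c * a) = (3 + 3 * k) * a * b * c"
    and pos: "0 < a" "0 < b" "0 < c"
  defines "d \<equiv> (a\<^sup>2 + k * a * b + b\<^sup>2) div c"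
  shows "0 < d" "a\<^sup>2 + d\<^sup>2 + b\<^sup>2 + k * (a * d + d * b + b * a) = (3 + 3 * k) * a * d * b"
proof -
  have cd: "c * d = a\<^sup>2 + k * a * b + b\<^sup>2"
    unfolding d_def using markov_equation_exact[OF eq] by simp
  with pos show "0 < d"
    by (metis add_gr_0 gr0I mult_0_right not_gr_zero zero_less_power)
  have "int c * ((3 + 3 * int k) * int a * int b - int k * (int a + int b) - int c)
      = (int a)\<^sup>2 + int k * int a * int b + (int b)\<^sup>2"
    using arg_cong[OF eq, of int] by (simp add: algebra_simps power2_eq_square)
  also have "\<dots> = int c * int d"
    using arg_cong[OF cd, of int] by simp
  finally have s: "int c = (3 + 3 * int k) * int a * int b - int k * (int a + int b) - int d"
    using pos by simp
  have "int d * ((3 + 3 * int k) * int a * int b - int k * (int a + int b) - int d)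
      = (int a)\<^sup>2 + int k * int a * int b + (int b)\<^sup>2"
    using arg_cong[OF cd, of int] s by (metis mult.commute of_nat_add of_nat_mult of_nat_power)
  then have "int (a\<^sup>2 + d\<^sup>2 + b\<^sup>2 + k * (a * d + d * b + b * a)) = int ((3 + 3 * k) * a * d * b)"
    by (simp add: algebra_simps power2_eq_square)
  then show "a\<^sup>2 + d\<^sup>2 + b\<^sup>2 + k * (a * d + d * b + b * a) = (3 + 3 * k) * a * d * b"
    by (simp only: of_nat_eq_iff)
qed

lemma markov_vertex_equation:
  "case markov_vertex k w of (a, b, c) \<Rightarrow> 0 < a \<and> 0 < b \<and> 0 < c \<and>
     a\<^sup>2 + b\<^sup>2 + c\<^sup>2 + k * (a * b + b * c + c * a) = (3 + 3 * k) * a * b * c"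
proof (induction w rule: rev_induct)
  case Nil
  show ?case
    by (simp add: markov_vertex_def markov_root_def power2_eq_square algebra_simps)
next
  case (snoc d w)
  obtain a b c where v: "markov_vertex k w = (a, b, c)"
    by (cases "markov_vertex k w")
  then have child: "markov_vertex k (w @ [d]) = markov_child k d (a, b, c)"
    by (simp add: markov_vertex_def)
  have pos: "0 < a" "0 < b" "0 < c"
    and eq: "a\<^sup>2 + b\<^sup>2 + c\<^sup>2 + k * (a * b + b * c + c * a) = (3 + 3 * k) * a * b * c"
    using snoc.IH v by auto
  have eq': "b\<^sup>2 + c\<^sup>2 + a\<^sup>2 + k * (b * c + c * a + a * b) = (3 + 3 * k) * b * c * a"
    using eq by (simp add: ac_simps)
  show ?case
    using markov_equation_step[OF eq pos] markov_equation_step[OF eq' pos(2,3,1)] pos child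
    by (cases d) simp_all
qed

lemma markov_vertex_exact:
  assumes "markov_vertex k w = (a, b, c)"
  shows "c dvd a\<^sup>2 + k * a * b + b\<^sup>2" "a dvd b\<^sup>2 + k * b * c + c\<^sup>2"
proof -
  have eq: "a\<^sup>2 + b\<^sup>2 + c\<^sup>2 + k * (a * b + b * c + c * a) = (3 + 3 * k) * a * b * c"
    using markov_vertex_equation[of k w] assms by simp
  show "c dvd a\<^sup>2 + k * a * b + b\<^sup>2"
    using markov_equation_exact[OF eq] .
  have eq': "b\<^sup>2 + c\<^sup>2 + a\<^sup>2 + k * (b * c + c * a + a * b) = (3 + 3 * k) * b * c * a"
    using eq by (simp add: ac_simps)
  show "a dvd b\<^sup>2 + k * b * c + c\<^sup>2"
    using markov_equation_exact[OF eq'] .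
qed

lemma farey_vertex_form:
  "\<exists>a b e f. farey_vertex w = ((a, b), (a + e, b + f), (e, f)) \<and> e * b = a * f + 1"
proof (induction w rule: rev_induct)
  case Nil
  show ?case by (simp add: farey_vertex_def farey_root_def)
next
  case (snoc d w)
  then obtain a b e f
    where v: "farey_vertex w = ((a, b), (a + e, b + f), (e, f))" and det: "e * b = a * f + 1"
    by blast
  then show ?case
    by (cases d) (auto simp: farey_vertex_def mediant_def algebra_simps)
qed

lemma inj_farey_vertex: "inj farey_vertex"
proof
  fix v w
  assume "farey_vertex v = farey_vertex w"
  then show "v = w"
  proof (induction v arbitrary: w rule: rev_induct)
    case Nil
    show ?case
    proof (cases w rule: rev_cases)
      case (snoc w' d)
      obtain a b e f where "farey_vertex w' = ((a, b), (a + e, b + f), (e, f))" "e * b = a * f + 1"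
        using farey_vertex_form by blast
      with Nil snoc show ?thesis
        by (cases d) (auto simp: farey_vertex_def farey_root_def mediant_def)
    qed simp
  next
    case (snoc d v)
    obtain a b e f where v: "farey_vertex v = ((a, b), (a + e, b + f), (e, f))" "e * b = a * f + 1"
      using farey_vertex_form by blast
    show ?case
    proof (cases w rule: rev_cases)
      case Nil
      with snoc.prems v show ?thesis
        by (cases d) (auto simp: farey_vertex_def farey_root_def mediant_def)
    next
      case w: (snoc w' d')
      obtain a' b' e' f'
        where w': "farey_vertex w' = ((a', b'), (a' + e', b' + f'), (e', f'))" "e' * b' = a' * f' + 1"
        using farey_vertex_form by blast
      have "d = d' \<and> farey_vertex v = farey_vertex w'"
        using snoc.prems v w w'
        by (cases d; cases d') (auto simp: farey_vertex_def mediant_def)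
      with snoc.IH w show ?thesis by simp
    qed
  qed
qed

lemma theta_farey_vertex: "theta k (farey_vertex w) = markov_vertex k w"
  by (simp add: theta_def inj_eq[OF inj_farey_vertex])

type_synonym point = "real \<times> real"

definition lattice_point :: "int \<Rightarrow> int \<Rightarrow> point" where
  "lattice_point i j = (of_int i, of_int j)"

definition unit_square :: "int \<Rightarrow> int \<Rightarrow> point set" where
  "unit_square i j = cbox (lattice_point i j) (lattice_point (i + 1) (j + 1))"

text \<open>The fraction a/b belongs to the segment from the origin to (b, a).\<close>

definition endpoint :: "fraction \<Rightarrow> point" where
  "endpoint t = (real (snd t), real (fst t))"

definition line_segment :: "fraction \<Rightarrow> point set" where
  "line_segment t = closed_segment (0, 0) (endpoint t)"

definition on_or_above :: "fraction \<Rightarrow> point set" where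
  "on_or_above t = {(x, y). real (fst t) * x \<le> real (snd t) * y}"

datatype cell = Triangle point point point | Edge point point

fun cell_set :: "cell \<Rightarrow> point set" where
  "cell_set (Triangle p q r) = convex hull {p, q, r}"
| "cell_set (Edge p q) = closed_segment p q"

definition snake_squares :: "fraction \<Rightarrow> (int \<times> int) set" where
  "snake_squares t = {(i, j). interior (unit_square i j) \<inter> line_segment t \<noteq> {}}"

definition snake_triangles :: "fraction \<Rightarrow> cell set" where
  "snake_triangles t = (\<Union>(i, j) \<in> snake_squares t.
     {Triangle (lattice_point i j) (lattice_point (i + 1) j) (lattice_point i (j + 1)),
      Triangle (lattice_point (i + 1) (j + 1)) (lattice_point i (j + 1)) (lattice_point (i + 1) j)})"

text \<open>Endpoints are listed left to right, and bottom to top on vertical sides, so that a side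
  shared by two squares is a single cell.\<close>

definition snake_edges :: "fraction \<Rightarrow> cell set" where
  "snake_edges t = (\<Union>(i, j) \<in> snake_squares t.
     {Edge (lattice_point i j) (lattice_point (i + 1) j),
      Edge (lattice_point i (j + 1)) (lattice_point (i + 1) (j + 1)),
      Edge (lattice_point i j) (lattice_point i (j + 1)),
      Edge (lattice_point (i + 1) j) (lattice_point (i + 1) (j + 1)),
      Edge (lattice_point i (j + 1)) (lattice_point (i + 1) j)})"

definition crossed_edges :: "fraction \<Rightarrow> cell set" where
  "crossed_edges t = {e \<in> snake_edges t. cell_set e \<inter> open_segment (0, 0) (endpoint t) \<noteq> {}}"

text \<open>A triangle precedes the edge through which the segment leaves it, and an edge precedes the
  triangle which the segment enters through it; the converse relations fail because the segment
  meets a triangle in more than one point.\<close>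

definition precedes :: "fraction \<Rightarrow> cell \<Rightarrow> cell \<Rightarrow> bool" where
  "precedes t c d \<longleftrightarrow>
     (\<forall>p \<in> cell_set c \<inter> line_segment t. \<forall>q \<in> cell_set d \<inter> line_segment t. fst p \<le> fst q)"

definition passed_cells :: "fraction \<Rightarrow> cell list" where
  "passed_cells t = (THE cs. distinct cs \<and> set cs = snake_triangles t \<union> crossed_edges t \<and>
     sorted_wrt (precedes t) cs)"

definition is_quadrilateral :: "point set \<Rightarrow> bool" where
  "is_quadrilateral S \<longleftrightarrow> polytope S \<and> card {p. p extreme_point_of S} = 4"

definition first_triangle :: "fraction \<Rightarrow> cell \<Rightarrow> bool" where
  "first_triangle t c \<longleftrightarrow>
     c \<in> snake_triangles t \<and> (\<forall>d \<in> snake_triangles t. d \<noteq> c \<longrightarrow> precedes t c d)"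

datatype sign = Minus | Plus

fun cell_signs :: "nat \<Rightarrow> fraction \<Rightarrow> cell \<Rightarrow> sign list" where
  "cell_signs k t (Triangle p q r) =
     [if first_triangle t (Triangle p q r)
         \<or> is_quadrilateral (cell_set (Triangle p q r) \<inter> on_or_above t) then Minus else Plus]"
| "cell_signs k t (Edge p q) = replicate k (if midpoint p q \<in> on_or_above t then Minus else Plus)"

definition sign_sequence :: "nat \<Rightarrow> fraction \<Rightarrow> sign list" where
  "sign_sequence k t = concat (map (cell_signs k t) (passed_cells t))"

function block_lengths :: "'a list \<Rightarrow> nat list" where
  "block_lengths [] = []"
| "block_lengths (x # xs) =
     Suc (length (takeWhile (\<lambda>y. y = x) xs)) # block_lengths (dropWhile (\<lambda>y. y = x) xs)"
  by pat_completeness auto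
termination
  by (relation "Wellfounded.measure length") (auto simp: le_imp_less_Suc length_dropWhile_le)

definition F_plus :: "nat \<Rightarrow> fraction \<Rightarrow> nat list" where
  "F_plus k t = block_lengths (sign_sequence k t)"

text \<open>The value at the empty list is irrelevant.\<close>

fun cfrac_value :: "nat list \<Rightarrow> real" where
  "cfrac_value [] = 0"
| "cfrac_value [a] = real a"
| "cfrac_value (a # b # as) = real a + 1 / cfrac_value (b # as)"

end

theory Submission
  imports Defs
begin

text \<open>
  Reading \<open>Minus\<close> as the matrix \<open>(1 1; 0 1)\<close> and \<open>Plus\<close> as \<open>(1 0; 1 1)\<close>, the continued fraction of the block
  lengths of a sign word that starts with \<open>Minus\<close> and ends with \<open>Plus\<close> is the quotient of the entries in
  the first column of the product. Along the segment of \<open>t = a/b\<close> all signs are determined by the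
  residues \<open>d * a mod (a + b)\<close>. The rotation of the segment about its midpoint transposes the matrix,
  up to the sign attached to the central edge, and for Farey neighbours \<open>r < t < s\<close> the word of \<open>t\<close> is
  the concatenation of those of \<open>s\<close> and \<open>r\<close> with a fixed word inserted. So the matrices \<open>Q\<close> satisfy
  \<open>Q_t\<^sup>T = Q_s J Q_r\<close> with a constant matrix \<open>J\<close>, as Cohn matrices do, and by induction along the Farey
  tree \<open>Q_t\<close> has the form \<open>(m u+k; u w)\<close>, where \<open>m\<close> is the Markov number of \<open>t\<close> and
  \<open>m_r u - m (u_r + k) = m_s\<close>.
\<close>

section \<open>Sign words\<close>

text \<open>The tie shapes the proof. Since numerator and denominator are coprime, the midpoint of
  the segment is always the midpoint of an edge, and reversing and flipping the word changes only
  the \<open>k\<close> signs on that edge. So the matrix of a word is \<open>A M A^T\<close> with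
  \<open>M = (1 k; 0 1)\<close> and \<open>det A = 1\<close>, which is why the off-diagonal entries
  differ by \<open>k\<close>; the formal argument extracts this from the Markov equation instead.
  Concatenation yields the word of the mediant in one convention from those of its neighbours in the
  other, whence the transpose on one side only.

  The induction cannot start at the root of the tree, because 1/0 has no snake word; it starts at
  the left child. Modulo \<open>m\<close> the relation with the left neighbour is the congruence
  defining \<open>u_plus\<close>, and the bounds on \<open>u\<close> carried along the tree single
  out the right representative.\<close>

fun flip :: "sign \<Rightarrow> sign" where
  "flip Minus = Plus"
| "flip Plus = Minus"

text \<open>The argument \<open>p\<close> is the sign given to an edge whose midpoint lies on the segment. There is at
  most one such edge, the central one; \<open>p = Minus\<close> is the convention of \<open>F_plus\<close>, and the other
  convention appears in the concatenation law.\<close>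

definition side_sign :: "sign \<Rightarrow> nat \<Rightarrow> nat \<Rightarrow> sign" where
  "side_sign p c n = (if n < c then Minus else if n = c then p else Plus)"

text \<open>With \<open>c = a + b\<close>, the segment crosses the diagonals on the lines \<open>x + y = d\<close> for \<open>0 < d < c\<close>, at
  height \<open>(d * a mod c) / c\<close> above the lower end point. All signs are functions of these residues:
  twice the residue is compared with \<open>c\<close> for a diagonal, and the sum of two consecutive residues for
  the side between two diagonals, which is vertical if and only if the residue increases.\<close>

definition diagonal_signs :: "sign \<Rightarrow> nat \<Rightarrow> nat \<Rightarrow> nat \<Rightarrow> nat \<Rightarrow> sign list" where
  "diagonal_signs p k a c d = replicate k (side_sign p c (2 * (d * a mod c)))"

definition crossing_signs :: "sign \<Rightarrow> nat \<Rightarrow> nat \<Rightarrow> nat \<Rightarrow> nat \<Rightarrow> sign list" where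
  "crossing_signs p k a c d =
     (let e = replicate k (side_sign p c (d * a mod c + Suc d * a mod c))
      in if d * a mod c < Suc d * a mod c then Minus # e @ [Plus] else Plus # e @ [Minus])"

definition inner_word :: "sign \<Rightarrow> nat \<Rightarrow> nat \<Rightarrow> nat \<Rightarrow> sign list" where
  "inner_word p k a c =
     concat (map (\<lambda>d. diagonal_signs p k a c d @ crossing_signs p k a c d) [1..<c - 1])
       @ diagonal_signs p k a c (c - 1)"

definition snake_word :: "sign \<Rightarrow> nat \<Rightarrow> nat \<Rightarrow> nat \<Rightarrow> sign list" where
  "snake_word p k a c = Minus # inner_word p k a c @ [Plus]"

section \<open>Residues of diagonals and the half-turn of the segment\<close>

lemma mult_mod_pos:
  fixes a c d :: nat
  assumes "coprime a c" "0 < d" "d < c"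
  shows "0 < d * a mod c"
proof (rule ccontr)
  assume "\<not> ?thesis"
  then have "c dvd d * a" by auto
  then have "c dvd d" using assms(1) by (simp add: coprime_commute coprime_dvd_mult_left_iff)
  then show False using assms by (auto dest: dvd_imp_le)
qed

lemma dvd_less_twice:
  fixes c s :: nat
  assumes "c dvd s" "0 < s" "s < 2 * c"
  shows "s = c"
proof -
  obtain q where q: "s = c * q" using assms(1) by blast
  then have "q < 2" "0 < q" using assms(2,3) by (auto simp: mult.commute)
  then have "q = 1" by linarith
  then show ?thesis using q by simp
qed

text \<open>The two residues sum to a multiple of \<open>c\<close>. Coprimality keeps both strictly
  between 0 and \<open>c\<close>, so the multiple is \<open>c\<close> itself.\<close>

lemma mult_mod_complement:
  fixes a c d :: nat
  assumes "coprime a c" "0 < d" "d < c"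
  shows "(c - d) * a mod c = c - d * a mod c"
proof -
  have "(c - d) * a mod c + d * a mod c = c"
  proof -
    have "[(c - d) * a + d * a = 0] (mod c)"
      using assms by (simp add: cong_def flip: distrib_right)
    then have "c dvd (c - d) * a mod c + d * a mod c"
      by (metis cong_0_iff mod_add_eq mod_0_imp_dvd cong_def mod_mod_trivial)
    moreover have "0 < d * a mod c" "0 < (c - d) * a mod c"
      using assms by (auto intro!: mult_mod_pos)
    moreover have "d * a mod c < c" "(c - d) * a mod c < c" using assms by auto
    ultimately show ?thesis
      by (intro dvd_less_twice) (assumption | linarith)+
  qed
  then show ?thesis by simp
qed

lemma mult_mod_Suc_neq:
  fixes a c d :: nat
  assumes "0 < a" "a < c"
  shows "Suc d * a mod c \<noteq> d * a mod c"
proof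
  assume "Suc d * a mod c = d * a mod c"
  then have "[a + d * a = 0 + d * a] (mod c)" by (simp add: cong_def)
  then have "[a = 0] (mod c)" by (simp only: cong_add_rcancel_nat)
  then show False using assms by (simp add: cong_def)
qed

text \<open>The reflection of \<open>n\<close> to \<open>2 * c - n\<close> exchanges the strict
  cases but fixes the tie \<open>n = c\<close>, where \<open>flip\<close> turns the
  \<open>Minus\<close> of one convention into the \<open>Plus\<close> of the other.\<close>

lemma side_sign_flip:
  assumes "n \<le> 2 * c"
  shows "flip (side_sign Minus c n) = side_sign Plus c (2 * c - n)"
  using assms by (auto simp: side_sign_def)

lemma diagonal_signs_flip:
  assumes "coprime a c" "0 < d" "d < c"
  shows "map flip (diagonal_signs Minus k a c d) = diagonal_signs Plus k a c (c - d)"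
proof -
  have "d * a mod c < c" using assms by simp
  then show ?thesis
    using side_sign_flip[of "2 * (d * a mod c)" c]
    by (simp add: diagonal_signs_def mult_mod_complement[OF assms] diff_mult_distrib2)
qed

text \<open>The half-turn reverses the order of the two diagonals and complements their residues.
  The effects cancel: a vertical side stays vertical, and the outer pair of signs is its own
  reversed flip.\<close>

lemma crossing_signs_flip:
  assumes "coprime a c" "0 < a" "a < c" "0 < d" "Suc d < c"
  shows "map flip (rev (crossing_signs Minus k a c d)) = crossing_signs Plus k a c (c - Suc d)"
proof -
  define y y' where "y = d * a mod c" and "y' = Suc d * a mod c"
  have lt: "y < c" "y' < c" using assms by (auto simp: y_def y'_def)
  have ne: "y' \<noteq> y" using mult_mod_Suc_neq assms unfolding y_def y'_def by blast
  have c1: "(c - Suc d) * a mod c = c - y'"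
    using mult_mod_complement[of a c "Suc d"] assms unfolding y'_def by simp
  have "Suc (c - Suc d) = c - d" using assms by simp
  then have c2: "Suc (c - Suc d) * a mod c = c - y"
    using mult_mod_complement[of a c "d"] assms unfolding y_def by simp
  have "flip (side_sign Minus c (y + y')) = side_sign Plus c (c - y' + (c - y))"
    using side_sign_flip[of "y + y'" c] lt by (simp add: add.commute mult_2)
  then show ?thesis
    unfolding crossing_signs_def c1 c2 y_def[symmetric] y'_def[symmetric] using ne lt
    by (auto simp: Let_def)
qed

text \<open>An alternating word that begins and ends with an \<open>f\<close> can be bracketed from
  either end; reversal turns one bracketing into the other.\<close>

lemma concat_upt_shift:
  assumes "0 < n"
  shows "concat (map (\<lambda>d. f d @ g d) [1..<n]) @ f n = f 1 @ concat (map (\<lambda>d. g d @ f (Suc d)) [1..<n])"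
  using assms
proof (induction n)
  case (Suc n)
  then show ?case by (cases "n = 0") auto
qed simp

lemma inner_word_flip:
  assumes "coprime a c" "0 < a" "a < c"
  shows "map flip (rev (inner_word Minus k a c)) = inner_word Plus k a c"
proof -
  let ?D = "diagonal_signs Minus k a c" and ?X = "crossing_signs Minus k a c"
  let ?D' = "diagonal_signs Plus k a c" and ?X' = "crossing_signs Plus k a c"
  have c: "1 < c" using assms by simp
  have rev_upt: "rev [1..<c - 1] = map (\<lambda>d. c - Suc d) [1..<c - 1]"
    by (rule nth_equalityI) (auto simp: rev_nth)
  have revD: "map flip (rev (?D d)) = ?D' (c - d)" if "0 < d" "d < c" for d
    using diagonal_signs_flip[OF assms(1) that, of k] by (simp add: diagonal_signs_def)
  have "map flip (rev (inner_word Minus k a c)) =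
      ?D' 1 @ concat (map (\<lambda>d. map flip (rev (?X d)) @ map flip (rev (?D d))) (rev [1..<c - 1]))"
    unfolding inner_word_def using revD[of "c - 1"] c
    by (simp add: rev_concat map_concat rev_map comp_def)
  also have "map (\<lambda>d. map flip (rev (?X d)) @ map flip (rev (?D d))) (rev [1..<c - 1]) =
      map (\<lambda>d. ?X' d @ ?D' (Suc d)) [1..<c - 1]"
    unfolding rev_upt map_map comp_def
  proof (rule map_cong[OF refl])
    fix d assume "d \<in> set [1..<c - 1]"
    then have d: "0 < d" "Suc d < c" by auto
    show "map flip (rev (?X (c - Suc d))) @ map flip (rev (?D (c - Suc d))) = ?X' d @ ?D' (Suc d)"
      using revD[of "c - Suc d"] crossing_signs_flip[OF assms, of "c - Suc d"] d
      by (simp add: Suc_diff_Suc)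
  qed
  finally show ?thesis
    unfolding inner_word_def using concat_upt_shift[of "c - 1" ?D' ?X'] c by simp
qed

lemma snake_word_flip:
  assumes "coprime a c" "0 < a" "a < c"
  shows "map flip (rev (snake_word Minus k a c)) = snake_word Plus k a c"
  by (simp add: snake_word_def inner_word_flip[OF assms, symmetric])

text \<open>The quotient \<open>N / c\<close> falls short of \<open>n / c'\<close> by less than
  \<open>2 / c\<close>. A tie on the right thus becomes a strict \<open>Minus\<close> on the left,
  while \<open>n > c'\<close> allows \<open>N = c\<close> at worst, where the convention
  \<open>Plus\<close> still gives the correct sign.\<close>

lemma side_sign_transfer:
  assumes eq: "c' * N + e = c * n" and e: "0 < e" "e < 2 * c'" and c: "c' \<le> c"
  shows "side_sign Plus c N = side_sign Minus c' n"
proof (cases "n \<le> c'")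
  case True
  then have "c * n \<le> c' * c" by (simp add: mult.commute)
  then have "c' * N < c' * c" using eq e by linarith
  then show ?thesis using True by (auto simp: side_sign_def)
next
  case False
  then have "c * Suc c' \<le> c * n" by (intro mult_le_mono) auto
  then have "c' * c + c \<le> c' * N + e" using eq by (simp add: mult.commute)
  then have "c' * c < c' * Suc N" using e c by simp
  then have "c < Suc N" by (simp only: mult_less_cancel1)
  then show ?thesis using False by (auto simp: side_sign_def)
qed

text \<open>For Farey neighbours \<open>r < s\<close> with mediant \<open>t\<close>, the segment of \<open>t\<close> runs just below the path that
  follows first the segment of \<open>s\<close> and then that of \<open>r\<close>. The midpoints of these two segments lie above
  the segment of \<open>t\<close>, whose own midpoint lies below the path: hence the two conventions.\<close>

context
  fixes ar cr as cs a c :: nat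
  assumes det: "as * cr = ar * cs + 1"
  defines "a \<equiv> ar + as" and "c \<equiv> cr + cs"
begin

lemma farey_coprime: "coprime as cs" "coprime ar cr"
  using det by (metis add.commute coprime_Suc_right_nat coprime_commute coprime_mult_left_iff
      coprime_mult_right_iff plus_1_eq_Suc coprime_Suc_left_nat)+

text \<open>By the determinant, \<open>a / c\<close> is smaller than \<open>as / cs\<close> by
  \<open>1 / (c * cs)\<close>. The accumulated defect \<open>d / (c * cs)\<close> stays below
  \<open>1 / cs\<close>, the least possible fractional part of \<open>d * as / cs\<close>, so the
  integer parts agree.\<close>

lemma upper_residue:
  assumes d: "0 < d" "d < cs"
  shows "cs * (d * a mod c) + d = c * (d * as mod cs)"
proof -
  define j y where "j = d * as div cs" and "y = d * as mod cs"
  have das: "int d * int as = int cs * int j + int y"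
    unfolding j_def y_def by (metis mult_div_mod_eq of_nat_add of_nat_mult)
  have y: "0 < y" "y < cs"
    using mult_mod_pos[OF farey_coprime(1) d] d by (auto simp: y_def)
  have "int cs * int a = int as * int c - 1"
    using arg_cong[OF det, of int] by (simp add: a_def c_def algebra_simps)
  then have "int cs * (int d * int a - int c * int j) = int d * (int as * int c - 1) - int cs * int c * int j"
    by (metis (no_types, opaque_lifting) mult.assoc mult.left_commute right_diff_distrib')
  also have "\<dots> = int c * int y - int d"
    using das by (simp add: algebra_simps) (metis distrib_left mult.commute mult.left_commute)
  finally have eq: "int cs * (int d * int a - int c * int j) = int c * int y - int d" .
  have "int c * 1 \<le> int c * int y" "int c * int y \<le> int c * (int cs - 1)"
    using y by (intro mult_left_mono; simp)+
  moreover have "d < c" using d by (simp add: c_def)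
  moreover have "int c * (int cs - 1) = int cs * int c - int c" by (simp add: algebra_simps)
  ultimately have "0 < int cs * (int d * int a - int c * int j)"
      "int cs * (int d * int a - int c * int j) < int cs * int c"
    unfolding eq using d by linarith+
  then have Y: "0 < int d * int a - int c * int j" "int d * int a - int c * int j < int c"
    using d by (auto simp: zero_less_mult_iff)
  have "int (d * a) = (int d * int a - int c * int j) + int c * int j" by simp
  then have "int (d * a mod c) = int d * int a - int c * int j"
    unfolding zmod_int using Y by (simp only: mod_mult_self2 mod_pos_pos_trivial less_imp_le)
  then have "int (cs * (d * a mod c) + d) = int (c * y)"
    using eq by simp
  then show ?thesis unfolding y_def by (simp only: of_nat_eq_iff)
qed

text \<open>The shift by \<open>cs\<close> subtracts 1 modulo \<open>c\<close>, as
  \<open>cs * a = as * c - 1\<close>. Since \<open>a / c\<close> exceeds \<open>ar / cr\<close> by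
  \<open>1 / (c * cr)\<close>, the total defect at \<open>d\<close> is
  \<open>1 / c - d / (c * cr)\<close>, which accounts for the term \<open>cr - d\<close>.\<close>

lemma lower_residue:
  assumes d: "0 < d" "d < cr"
  shows "cr * ((cs + d) * a mod c) + (cr - d) = c * (d * ar mod cr)"
proof -
  define j y where "j = d * ar div cr" and "y = d * ar mod cr"
  have das: "int d * int ar = int cr * int j + int y"
    unfolding j_def y_def by (metis mult_div_mod_eq of_nat_add of_nat_mult)
  have y: "0 < y" "y < cr"
    using mult_mod_pos[OF farey_coprime(2) d] d by (auto simp: y_def)
  have cra: "int cr * int a = int ar * int c + 1" and csa: "int cs * int a = int as * int c - 1"
    using arg_cong[OF det, of int] by (simp_all add: a_def c_def algebra_simps)
  define Y where "Y = int d * int a - 1 - int c * int j"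
  have "int cr * Y = int d * (int cr * int a) - int cr - int c * (int cr * int j)"
    by (simp add: Y_def algebra_simps)
  also have "\<dots> = int c * (int d * int ar - int cr * int j) + int d - int cr"
    unfolding cra by (simp add: algebra_simps)
  finally have eq: "int cr * Y = int c * int y - (int cr - int d)"
    using das by simp
  have "int c * 1 \<le> int c * int y" "int c * int y \<le> int c * (int cr - 1)"
    using y by (intro mult_left_mono; simp)+
  then have "0 < int cr * Y" "int cr * Y < int cr * int c"
    using eq d by (auto simp: algebra_simps c_def)
  then have Y: "0 < Y" "Y < int c"
    using d by (auto simp: zero_less_mult_iff)
  have "int ((cs + d) * a) = Y + int c * (int as + int j)"
    using csa by (simp add: Y_def algebra_simps)
  then have "int ((cs + d) * a mod c) = Y"
    using Y by (simp add: zmod_int)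
  then have "int (cr * ((cs + d) * a mod c) + (cr - d)) = int (c * y)"
    using eq d by (simp add: of_nat_diff)
  then show ?thesis unfolding y_def by (simp only: of_nat_eq_iff)
qed

lemma diagonal_signs_upper:
  assumes d: "0 < d" "d < cs"
  shows "diagonal_signs Plus k a c d = diagonal_signs Minus k as cs d"
proof -
  have "cs * (2 * (d * a mod c)) + 2 * d = c * (2 * (d * as mod cs))"
    using upper_residue[OF d] by simp
  then have "side_sign Plus c (2 * (d * a mod c)) = side_sign Minus cs (2 * (d * as mod cs))"
    by (rule side_sign_transfer) (use d in \<open>auto simp: c_def\<close>)
  then show ?thesis by (simp add: diagonal_signs_def)
qed

lemma diagonal_signs_lower:
  assumes d: "0 < d" "d < cr"
  shows "diagonal_signs Plus k a c (cs + d) = diagonal_signs Minus k ar cr d"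
proof -
  have "cr * (2 * ((cs + d) * a mod c)) + 2 * (cr - d) = c * (2 * (d * ar mod cr))"
    using lower_residue[OF d] by simp
  then have "side_sign Plus c (2 * ((cs + d) * a mod c)) = side_sign Minus cr (2 * (d * ar mod cr))"
    by (rule side_sign_transfer) (use d in \<open>auto simp: c_def\<close>)
  then show ?thesis by (simp add: diagonal_signs_def)
qed

lemma crossing_signs_upper:
  assumes d: "0 < d" "Suc d < cs"
  shows "crossing_signs Plus k a c d = crossing_signs Minus k as cs d"
proof -
  define y y' z z' where "y = d * a mod c" and "y' = Suc d * a mod c"
    and "z = d * as mod cs" and "z' = Suc d * as mod cs"
  have 1: "cs * y + d = c * z" and 2: "cs * y' + Suc d = c * z'"
    using upper_residue[of d] upper_residue[of "Suc d"] d unfolding y_def y'_def z_def z'_def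
    by auto
  have "cs * (y + y') + (d + Suc d) = c * (z + z')"
    using 1 2 by (simp add: algebra_simps)
  then have sgn: "side_sign Plus c (y + y') = side_sign Minus cs (z + z')"
    by (rule side_sign_transfer) (use d in \<open>auto simp: c_def\<close>)
  have "y < y' \<longleftrightarrow> z < z'"
  proof (cases "z < z'")
    case True
    then have "c * Suc z \<le> c * z'" by (intro mult_le_mono) auto
    then have "c * z + c \<le> c * z'" by simp
    moreover have "cs \<le> c" by (simp add: c_def)
    ultimately have "cs * y < cs * y'" using 1 2 d by linarith
    then show ?thesis using True by simp
  next
    case False
    then have "c * z' \<le> c * z" by simp
    then have "cs * y' < cs * y" using 1 2 by linarith
    then show ?thesis using False by simp
  qed
  with sgn show ?thesis
    unfolding crossing_signs_def y_def y'_def z_def z'_def by simp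
qed

lemma crossing_signs_lower:
  assumes d: "0 < d" "Suc d < cr" and ar: "0 < ar" "ar < cr"
  shows "crossing_signs Plus k a c (cs + d) = crossing_signs Minus k ar cr d"
proof -
  define y y' z z' where "y = (cs + d) * a mod c" and "y' = Suc (cs + d) * a mod c"
    and "z = d * ar mod cr" and "z' = Suc d * ar mod cr"
  have 1: "cr * y + (cr - d) = c * z" and 2: "cr * y' + (cr - Suc d) = c * z'"
    using lower_residue[of d] lower_residue[of "Suc d"] d unfolding y_def y'_def z_def z'_def
    by auto
  have "cr * (y + y') + ((cr - d) + (cr - Suc d)) = c * (z + z')"
    using 1 2 by (simp add: algebra_simps)
  then have sgn: "side_sign Plus c (y + y') = side_sign Minus cr (z + z')"
    by (rule side_sign_transfer) (use d in \<open>auto simp: c_def\<close>)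
  have "y < y' \<longleftrightarrow> z < z'"
  proof (cases "z < z'")
    case True
    then have "c * Suc z \<le> c * z'" by (intro mult_le_mono) auto
    then have "c * z + c \<le> c * z'" by simp
    moreover have "cr \<le> c" by (simp add: c_def)
    ultimately have "cr * y < cr * y'" using 1 2 d by linarith
    then show ?thesis using True by simp
  next
    case False
    \<comment> \<open>The offset \<open>cr - d\<close> shrinks as \<open>d\<close> grows, so equal
      residues would give \<open>y < y'\<close>. For the upper neighbour the offset \<open>d\<close>
      grows and equality is harmless.\<close>
    moreover have "z' \<noteq> z" using mult_mod_Suc_neq ar unfolding z_def z'_def by blast
    ultimately have "c * Suc z' \<le> c * z" by (intro mult_le_mono) auto
    then have "c * z' + c \<le> c * z" by simp
    moreover have "cr \<le> c" by (simp add: c_def)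
    ultimately have "cr * y' \<le> cr * y" using 1 2 d by linarith
    then show ?thesis using False d by simp
  qed
  with sgn show ?thesis
    unfolding crossing_signs_def y_def y'_def z_def z'_def by simp
qed

text \<open>The common end point of the two shorter segments lies on \<open>x + y = cs\<close>, at
  height \<open>1 / c\<close> above the point where the longer segment crosses that line; hence the
  residue \<open>c - 1\<close>. Its neighbours differ from it by \<open>a\<close> modulo
  \<open>c\<close>.\<close>

lemma vertex_residues:
  assumes "0 < a" "a < c"
  shows "cs * a mod c = c - 1" "Suc cs * a mod c = a - 1"
    "0 < cs \<Longrightarrow> (cs - 1) * a mod c = c - 1 - a"
proof -
  have csa: "int cs * int a = (int c - 1) + int c * (int as - 1)"
    using arg_cong[OF det, of int] by (simp add: a_def c_def algebra_simps)
  have *: "n mod c = nat r" if "int n = r + int c * q" "0 \<le> r" "r < int c" for n r q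
  proof -
    have "int (n mod c) = r"
      unfolding zmod_int that(1) using that(2,3) by (simp only: mod_mult_self2 mod_pos_pos_trivial)
    then show ?thesis by simp
  qed
  show "cs * a mod c = c - 1"
    using *[of "cs * a" "int c - 1" "int as - 1"] csa assms by (simp add: nat_diff_distrib)
  show "Suc cs * a mod c = a - 1"
    using *[of "Suc cs * a" "int a - 1" "int as"] csa assms
    by (simp add: nat_diff_distrib algebra_simps)
  show "(cs - 1) * a mod c = c - 1 - a" if "0 < cs"
    using *[of "(cs - 1) * a" "int c - 1 - int a" "int as - 1"] csa assms that
    by (simp add: of_nat_diff nat_diff_distrib algebra_simps)
qed

lemma crossing_before_vertex:
  assumes "0 < a" "a + 1 < c" "0 < cs"
  shows "crossing_signs Plus k a c (cs - 1) = Minus # replicate (k + 1) Plus"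
proof -
  have "Suc (cs - 1) = cs" using assms by simp
  then show ?thesis
    using vertex_residues assms unfolding crossing_signs_def
    by (auto simp: Let_def side_sign_def replicate_append_same)
qed

lemma diagonal_at_vertex:
  assumes "0 < a" "a < c"
  shows "diagonal_signs Plus k a c cs = replicate k Plus"
  using vertex_residues assms unfolding diagonal_signs_def by (auto simp: side_sign_def)

lemma crossing_after_vertex:
  assumes "1 < a" "a < c"
  shows "crossing_signs Plus k a c cs = replicate (k + 1) Plus @ [Minus]"
  using vertex_residues assms unfolding crossing_signs_def by (auto simp: Let_def side_sign_def)

text \<open>Three crossed edges end in the common lattice point: a vertical side, a diagonal and a
  horizontal side. Their midpoints lie below the segment and the two triangles between them count
  \<open>Plus\<close>, which makes \<open>3 * k + 2\<close> signs; the triangles flanking this fan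
  give \<open>Minus\<close>.\<close>

lemma inner_word_join:
  assumes "0 < ar" "ar < cr" "0 < as" "as < cs"
  shows "inner_word Plus k a c =
    inner_word Minus k as cs @ Minus # replicate (3 * k + 2) Plus @ Minus # inner_word Minus k ar cr"
proof -
  have ac: "1 < a" "a + 1 < c" "1 < cs" "1 < cr" "a < c" "0 < a" "0 < cs"
    using assms by (auto simp: a_def c_def)
  let ?f = "\<lambda>d. diagonal_signs Plus k a c d @ crossing_signs Plus k a c d"
  let ?g = "\<lambda>d. diagonal_signs Minus k as cs d @ crossing_signs Minus k as cs d"
  let ?h = "\<lambda>d. diagonal_signs Minus k ar cr d @ crossing_signs Minus k ar cr d"
  have "[1..<c - 1] = [1..<(cs - 1) + (cr + 0)]"
    using ac by (simp add: c_def algebra_simps)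
  also have "\<dots> = [1..<cs - 1] @ [cs - 1..<(cs - 1) + cr]"
    using upt_add_eq_append[of 1 "cs - 1" cr] ac by simp
  also have "[cs - 1..<(cs - 1) + cr] = (cs - 1) # cs # [cs + 1..<cs + (cr - 1)]"
    using ac by (simp add: upt_conv_Cons)
  also have "[cs + 1..<cs + (cr - 1)] = map (\<lambda>d. cs + d) [1..<cr - 1]"
    by (rule nth_equalityI) auto
  finally have split: "[1..<c - 1] = [1..<cs - 1] @ (cs - 1) # cs # map (\<lambda>d. cs + d) [1..<cr - 1]" .
  have 1: "map ?f [1..<cs - 1] = map ?g [1..<cs - 1]"
    by (rule map_cong[OF refl]) (auto simp: diagonal_signs_upper crossing_signs_upper)
  have 2: "map (\<lambda>d. ?f (cs + d)) [1..<cr - 1] = map ?h [1..<cr - 1]"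
    using assms by (intro map_cong[OF refl]) (auto simp: diagonal_signs_lower crossing_signs_lower)
  have 3: "?f (cs - 1) = diagonal_signs Minus k as cs (cs - 1) @ Minus # replicate (k + 1) Plus"
    using diagonal_signs_upper[of "cs - 1"] crossing_before_vertex ac by simp
  have "2 * k + 1 = k + (k + 1)" by simp
  then have "replicate (2 * k + 1) Plus = replicate k Plus @ replicate (k + 1) Plus"
    by (simp only: replicate_add)
  then have 4: "?f cs = replicate (2 * k + 1) Plus @ [Minus]"
    using diagonal_at_vertex crossing_after_vertex ac by simp
  have "c - 1 = cs + (cr - 1)" using ac by (simp add: c_def)
  then have 5: "diagonal_signs Plus k a c (c - 1) = diagonal_signs Minus k ar cr (cr - 1)"
    using diagonal_signs_lower[of "cr - 1"] ac by simp
  have "3 * k + 2 = (k + 1) + (2 * k + 1)" by simp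
  then have 6: "replicate (3 * k + 2) Plus = replicate (k + 1) Plus @ replicate (2 * k + 1) Plus"
    by (simp only: replicate_add)
  show ?thesis
    unfolding inner_word_def split 5 6
    by (simp only: map_append map_map comp_def list.map concat_append concat.simps 1 2 3 4
        append_assoc append_Cons append_Nil)
qed

end

text \<open>Here the left neighbour is 0/1. The segment ends on the horizontal side of the fan, so
  only two of its three edges are crossed, and the sign of the last triangle belongs to
  \<open>snake_word\<close>.\<close>

lemma inner_word_unit:
  assumes "1 < c"
  shows "inner_word Plus k 1 (Suc c) = inner_word Minus k 1 c @ Minus # replicate (2 * k + 1) Plus"
proof -
  let ?f = "\<lambda>d. diagonal_signs Plus k 1 (Suc c) d @ crossing_signs Plus k 1 (Suc c) d"
  let ?g = "\<lambda>d. diagonal_signs Minus k 1 c d @ crossing_signs Minus k 1 c d"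
  have det: "1 * 1 = 0 * c + (1 :: nat)" by simp
  have split: "[1..<Suc c - 1] = [1..<c - 1] @ [c - 1]"
    using assms upt_Suc_append[of 1 "c - 1"] by simp
  have 1: "map ?f [1..<c - 1] = map ?g [1..<c - 1]"
    using diagonal_signs_upper[OF det] crossing_signs_upper[OF det]
    by (intro map_cong[OF refl]) auto
  have 2: "?f (c - 1) = diagonal_signs Minus k 1 c (c - 1) @ Minus # replicate (k + 1) Plus"
    using diagonal_signs_upper[OF det, of "c - 1"] crossing_before_vertex[OF det] assms by simp
  have 3: "diagonal_signs Plus k 1 (Suc c) (Suc c - 1) = replicate k Plus"
    using diagonal_at_vertex[OF det, of k] assms by simp
  have "2 * k + 1 = (k + 1) + k" by simp
  then have 4: "replicate (2 * k + 1) Plus = replicate (k + 1) Plus @ replicate k Plus"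
    by (simp only: replicate_add)
  show ?thesis
    unfolding inner_word_def split 3 4
    by (simp only: map_append list.map concat_append concat.simps 1 2
        append_assoc append_Cons append_Nil append_Nil2)
qed

section \<open>Continued fractions and matrix products\<close>

lemma cfrac_value_Suc: "cfrac_value (Suc n # ns) = 1 + cfrac_value (n # ns)"
  by (cases ns) auto

lemma block_lengths_same: "block_lengths (x # x # xs) = Suc (hd (block_lengths (x # xs))) # tl (block_lengths (x # xs))"
  by simp

lemma block_lengths_differ: "x \<noteq> y \<Longrightarrow> block_lengths (x # y # ys) = 1 # block_lengths (y # ys)"
  by simp

section \<open>Words as products of unimodular matrices\<close>

type_synonym matrix2 = "int \<times> int \<times> int \<times> int"

fun mmult :: "matrix2 \<Rightarrow> matrix2 \<Rightarrow> matrix2" where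
  "mmult (a, b, c, d) (a', b', c', d') =
     (a * a' + b * c', a * b' + b * d', c * a' + d * c', c * b' + d * d')"

fun mtranspose :: "matrix2 \<Rightarrow> matrix2" where
  "mtranspose (a, b, c, d) = (a, c, b, d)"

fun sign_matrix :: "sign \<Rightarrow> matrix2" where
  "sign_matrix Minus = (1, 1, 0, 1)"
| "sign_matrix Plus = (1, 0, 1, 1)"

primrec word_matrix :: "sign list \<Rightarrow> matrix2" where
  "word_matrix [] = (1, 0, 0, 1)"
| "word_matrix (x # xs) = mmult (sign_matrix x) (word_matrix xs)"

lemma mmult_assoc: "mmult (mmult A B) C = mmult A (mmult B C)"
  by (cases A; cases B; cases C) (simp add: algebra_simps)

lemma mmult_one [simp]: "mmult (1, 0, 0, 1) A = A" "mmult A (1, 0, 0, 1) = A"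
  by (cases A; simp)+

lemma word_matrix_append: "word_matrix (xs @ ys) = mmult (word_matrix xs) (word_matrix ys)"
  by (induction xs) (simp_all add: mmult_assoc)

lemma mtranspose_mmult: "mtranspose (mmult A B) = mmult (mtranspose B) (mtranspose A)"
  by (cases A; cases B) (simp add: algebra_simps)

lemma mtranspose_mtranspose [simp]: "mtranspose (mtranspose A) = A"
  by (cases A) simp

text \<open>Transposition swaps the matrices of the two signs and reverses products.\<close>

lemma word_matrix_flip: "word_matrix (map flip (rev xs)) = mtranspose (word_matrix xs)"
proof (induction xs)
  case (Cons x xs)
  then show ?case by (cases x) (simp_all add: word_matrix_append mtranspose_mmult)
qed simp

lemma word_matrix_replicate_Minus: "word_matrix (replicate n Minus) = (1, int n, 0, 1)"
  by (induction n) auto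

lemma word_matrix_replicate_Plus: "word_matrix (replicate n Plus) = (1, 0, int n, 1)"
  by (induction n) auto

text \<open>Induction adds a letter in front. An equal letter lengthens the first block and adds 1
  to the value; a different one opens a block of length 1 and sends the value \<open>x\<close> to
  \<open>1 + 1 / x\<close>. On the first column, \<open>Minus\<close> adds \<open>q\<close> to
  \<open>p\<close> and \<open>Plus\<close> adds \<open>p\<close> to \<open>q\<close>. The last
  letter \<open>Plus\<close> supplies the initial column \<open>(1, 1)\<close>.\<close>

lemma cfrac_value_block_lengths:
  assumes "xs \<noteq> []" "last xs = Plus" "word_matrix xs = (p, p', q, q')"
  shows "0 < p \<and> 0 < q \<and>
    cfrac_value (block_lengths xs) = (if hd xs = Minus then real_of_int p / q else real_of_int q / p)"
  using assms
proof (induction xs arbitrary: p p' q q')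
  case (Cons x xs)
  show ?case
  proof (cases xs)
    case Nil
    with Cons.prems show ?thesis by auto
  next
    case (Cons y ys)
    obtain r r' s s' where M: "word_matrix xs = (r, r', s, s')" by (cases "word_matrix xs")
    have IH: "0 < r" "0 < s"
      "cfrac_value (block_lengths xs) = (if y = Minus then real_of_int r / s else real_of_int s / r)"
      using Cons.IH[OF _ _ M] Cons Cons.prems by (auto split: if_splits)
    show ?thesis
    proof (cases "x = y")
      case True
      have "block_lengths (y # ys) = hd (block_lengths (y # ys)) # tl (block_lengths (y # ys))"
        by simp
      then have "cfrac_value (block_lengths (x # xs)) = 1 + cfrac_value (block_lengths xs)"
        unfolding True Cons block_lengths_same cfrac_value_Suc by simp
      with IH M Cons.prems True show ?thesis
        by (cases y) (auto simp: field_simps)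
    next
      case False
      have "cfrac_value (block_lengths (x # xs)) = 1 + 1 / cfrac_value (block_lengths xs)"
        unfolding Cons block_lengths_differ[OF False] by simp
      with IH M Cons.prems False show ?thesis
        by (cases x; cases y) (auto simp: field_simps)
    qed
  qed
qed simp

section \<open>Cohn matrices of Farey fractions\<close>

text \<open>The value at \<open>0/1\<close> is the one for which the mediant law below persists.\<close>

definition farey_matrix :: "nat \<Rightarrow> fraction \<Rightarrow> matrix2" where
  "farey_matrix k x = (if fst x = 0 then (1, 0, - int k, 1)
     else word_matrix (snake_word Minus k (fst x) (fst x + snd x)))"

text \<open>The effect of replacing the last \<open>Plus\<close> of a word by \<open>Minus\<close> followed by \<open>3 * k + 2\<close> times \<open>Plus\<close>,
  which are the signs read while passing below the common lattice point.\<close>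

definition joint_matrix :: "nat \<Rightarrow> matrix2" where
  "joint_matrix k = (3 * int k + 3, 1, - 1, 0)"

lemma joint_matrix_word:
  "mmult (mmult (word_matrix (xs @ [Plus])) (joint_matrix k)) Q =
    mmult (word_matrix (xs @ Minus # replicate (3 * k + 2) Plus)) Q"
proof -
  obtain x y z w where "word_matrix xs = (x, y, z, w)" by (cases "word_matrix xs")
  then show ?thesis
    by (simp add: word_matrix_append word_matrix_replicate_Plus joint_matrix_def algebra_simps
        del: replicate.simps replicate_Suc add_2_eq_Suc')
qed

lemma farey_matrix_mediant:
  assumes det: "ps * qr = pr * qs + 1" and pos: "0 < ps" "0 < qs"
  shows "mtranspose (farey_matrix k (pr + ps, qr + qs)) =
    mmult (mmult (farey_matrix k (ps, qs)) (joint_matrix k)) (farey_matrix k (pr, qr))"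
proof -
  define ar cr as cs where "ar = pr" and "cr = pr + qr" and "as = ps" and "cs = ps + qs"
  \<comment> \<open>Words have numerator plus denominator as modulus; adding the numerators to the
    denominators preserves the determinant.\<close>
  have det': "as * cr = ar * cs + 1"
    using det by (simp add: ar_def cr_def as_def cs_def algebra_simps)
  have det2: "(ar + as) * cr = ar * (cr + cs) + 1" using det' by (simp add: algebra_simps)
  have qr: "0 < qr" using det by (cases qr) auto
  have cop: "coprime (ar + as) (cr + cs)" using farey_coprime[OF det2] by simp
  have lt: "as < cs" "0 < as" "ar + as < cr + cs" "0 < ar + as"
    using pos qr by (auto simp: ar_def cr_def as_def cs_def)
  have L: "mtranspose (farey_matrix k (pr + ps, qr + qs)) = word_matrix (snake_word Plus k (ar + as) (cr + cs))"
  proof -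
    have "farey_matrix k (pr + ps, qr + qs) = word_matrix (snake_word Minus k (ar + as) (cr + cs))"
      using pos by (simp add: farey_matrix_def ar_def cr_def as_def cs_def algebra_simps)
    then show ?thesis
      using snake_word_flip[OF cop lt(4,3), of k] by (metis word_matrix_flip)
  qed
  have S: "farey_matrix k (ps, qs) = word_matrix ((Minus # inner_word Minus k as cs) @ [Plus])"
    using pos by (simp add: farey_matrix_def snake_word_def as_def cs_def)
  show ?thesis
  proof (cases "pr = 0")
    case True
    then have one: "ps = 1" "qr = 1" using det by auto
    let ?X = "Minus # inner_word Minus k as cs"
    have "snake_word Plus k (ar + as) (cr + cs) = ?X @ Minus # replicate (2 * k + 2) Plus"
      using inner_word_unit[of cs k] pos one True
      by (simp add: snake_word_def ar_def cr_def as_def cs_def replicate_append_same)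
    also have "word_matrix \<dots> = mmult (mmult (word_matrix ?X) (sign_matrix Minus)) (1, 0, 2 * int k + 2, 1)"
      by (simp only: word_matrix_append word_matrix.simps word_matrix_replicate_Plus mmult_assoc)
        (simp add: add.commute)
    \<comment> \<open>The exponent \<open>2 * k + 2\<close> falls short of \<open>3 * k + 2\<close>
      by \<open>k\<close>; this is the origin of the matrix assigned to 0/1.\<close>
    also have "\<dots> = mmult (mmult (word_matrix ?X) (sign_matrix Minus)) (mmult (1, 0, 3 * int k + 2, 1) (1, 0, - int k, 1))"
      by simp
    also have "\<dots> = mmult (word_matrix (?X @ Minus # replicate (3 * k + 2) Plus)) (1, 0, - int k, 1)"
      by (simp only: word_matrix_append word_matrix.simps word_matrix_replicate_Plus mmult_assoc)
        (simp add: add.commute)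
    finally show ?thesis
      unfolding L S joint_matrix_word using True by (simp only: farey_matrix_def fst_conv simp_thms if_True)
  next
    case False
    then have lt': "0 < ar" "ar < cr" using qr by (auto simp: ar_def cr_def)
    have R: "farey_matrix k (pr, qr) = word_matrix (snake_word Minus k ar cr)"
      using False by (simp add: farey_matrix_def ar_def cr_def)
    have "snake_word Plus k (ar + as) (cr + cs) =
        ((Minus # inner_word Minus k as cs) @ Minus # replicate (3 * k + 2) Plus) @ snake_word Minus k ar cr"
      unfolding snake_word_def using inner_word_join[OF det' lt' lt(2,1), of k] by simp
    then show ?thesis
      unfolding L S R joint_matrix_word by (simp only: word_matrix_append)
  qed
qed

section \<open>Markov numbers as matrix entries\<close>

definition cohn_entries :: "nat \<Rightarrow> fraction \<Rightarrow> nat \<Rightarrow> int \<Rightarrow> bool" where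
  "cohn_entries k x m u \<longleftrightarrow>
     (\<exists>w. farey_matrix k x = (int m, u + int k, u, w) \<and> int m * w = u * (u + int k) + 1)"

text \<open>\<open>X\<close> and \<open>Y\<close> form the first column of \<open>Q_y J\<close>. The
  product \<open>Q_y J Q_x\<close> then has first column \<open>m'\<close>,
  \<open>Y * mx + uy * ux\<close> and upper right entry \<open>u'\<close>. The hypotheses on
  \<open>m'\<close> are the product and the sum of \<open>z\<close> and \<open>m'\<close> as the two
  roots of the Markov equation with \<open>mx\<close> and \<open>my\<close> fixed.\<close>

lemma cohn_step_algebra:
  fixes k mx my z ux uy wx wy m' :: int
  assumes dx: "mx * wx = ux * (ux + k) + 1" and dy: "my * wy = uy * (uy + k) + 1"
    and z: "mx * uy - my * (ux + k) = z"
    and m': "m' * z = mx\<^sup>2 + k * mx * my + my\<^sup>2"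
    and m'': "m' = (3 * k + 3) * mx * my - k * (mx + my) - z"
    and nz: "mx \<noteq> 0" "my \<noteq> 0"
  defines "X \<equiv> (3 * k + 3) * my - (uy + k)" and "Y \<equiv> (3 * k + 3) * uy - wy"
  defines "u' \<equiv> X * (ux + k) + my * wx"
  shows "X * mx + my * ux = m'" "Y * mx + uy * ux = u' + k"
    "mx * u' - m' * (ux + k) = my" "m' * uy - my * (u' + k) = mx"
proof -
  show 1: "X * mx + my * ux = m'"
    unfolding m'' z[symmetric] X_def by (simp add: algebra_simps)
  have "mx * u' - m' * (ux + k) = my * (mx * wx - ux * (ux + k))"
    unfolding u'_def 1[symmetric] by (simp add: algebra_simps)
  then show 2: "mx * u' - m' * (ux + k) = my" unfolding dx by simp
  \<comment> \<open>The entries do not show that \<open>v\<close> and \<open>u'\<close> differ by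
    \<open>k\<close>. The determinants give one linear relation for each; together these express
    \<open>mx * my * (v - u')\<close> through \<open>m' * z\<close>, and the product of the roots
    leaves \<open>mx * my * k\<close>.\<close>
  define v where "v = Y * mx + uy * ux"
  have "m' * uy - my * v = mx * (my * wy - uy * (uy + k))"
    unfolding v_def 1[symmetric] X_def Y_def by (simp add: algebra_simps)
  then have 3: "m' * uy - my * v = mx" unfolding dy by simp
  have "mx * my * (v - u') = mx * (my * v) - my * (mx * u')"
    by (simp add: algebra_simps)
  also have "\<dots> = mx * (m' * uy - mx) - my * (my + m' * (ux + k))"
    using 2 3 by (metis add.commute diff_add_cancel diff_diff_eq2 add_diff_cancel_left')
  also have "\<dots> = m' * (mx * uy - my * (ux + k)) - mx\<^sup>2 - my\<^sup>2"
    by (simp add: algebra_simps power2_eq_square)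
  also have "\<dots> = mx * my * k"
    unfolding z m' by (simp add: algebra_simps)
  finally have "v - u' = k" using nz by (metis mult_cancel_left mult_eq_0_iff)
  then show "Y * mx + uy * ux = u' + k" "m' * uy - my * (u' + k) = mx"
    using 3 unfolding v_def by (simp_all add: algebra_simps)
qed

lemma farey_matrix_det:
  "case farey_matrix k x of (a, b, c, d) \<Rightarrow> a * d - b * c = 1"
proof -
  have "case word_matrix xs of (a, b, c, d) \<Rightarrow> a * d - b * c = 1" for xs
  proof (induction xs)
    case (Cons x xs)
    then show ?case by (cases "word_matrix xs"; cases x) (auto simp: algebra_simps)
  qed simp
  then show ?thesis by (auto simp: farey_matrix_def)
qed

text \<open>The bounds are weak enough to hold at 0/1, where \<open>ur = - int k\<close>. They
  return in strict form through the two new relations, whose terms \<open>ms\<close> and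
  \<open>mr\<close> are positive.\<close>

lemma cohn_entries_mediant:
  assumes det: "ps * qr = pr * qs + 1" and pos: "0 < ps" "0 < qs"
    and r: "cohn_entries k (pr, qr) mr ur" and s: "cohn_entries k (ps, qs) ms us"
    and z: "int mr * us - int ms * (ur + int k) = int z"
    and eq: "mr\<^sup>2 + ms\<^sup>2 + z\<^sup>2 + k * (mr * ms + ms * z + z * mr) = (3 + 3 * k) * mr * ms * z"
    and mpos: "0 < mr" "0 < ms" "0 < z"
    and bounds: "- int k \<le> ur" "us \<le> int ms"
  defines "m \<equiv> (mr\<^sup>2 + k * mr * ms + ms\<^sup>2) div z"
  obtains u where "cohn_entries k (pr + ps, qr + qs) m u"
    "int mr * u - int m * (ur + int k) = int ms" "int m * us - int ms * (u + int k) = int mr"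
    "0 < u" "u + int k < int m"
proof -
  have mz: "m * z = mr\<^sup>2 + k * mr * ms + ms\<^sup>2"
    unfolding m_def using markov_equation_exact[OF eq] by simp
  then have mz': "int m * int z = (int mr)\<^sup>2 + int k * int mr * int ms + (int ms)\<^sup>2"
    by (metis of_nat_add of_nat_mult of_nat_power)
  have mpos': "0 < m" using markov_equation_step(1)[OF eq mpos] unfolding m_def .
  have "(int mr)\<^sup>2 + (int ms)\<^sup>2 + (int z)\<^sup>2 + int k * (int mr * int ms + int ms * int z + int z * int mr) = (3 + 3 * int k) * int mr * int ms * int z"
    using arg_cong[OF eq, of int] by simp
  then have "int z * int m = int z * ((3 * int k + 3) * int mr * int ms - int k * (int mr + int ms) - int z)"
    using mz' by (simp add: algebra_simps power2_eq_square)
  then have m'': "int m = (3 * int k + 3) * int mr * int ms - int k * (int mr + int ms) - int z"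
    using mpos by simp
  obtain wr where wr: "farey_matrix k (pr, qr) = (int mr, ur + int k, ur, wr)"
      "int mr * wr = ur * (ur + int k) + 1"
    using r unfolding cohn_entries_def by blast
  obtain ws where ws: "farey_matrix k (ps, qs) = (int ms, us + int k, us, ws)"
      "int ms * ws = us * (us + int k) + 1"
    using s unfolding cohn_entries_def by blast
  define u where "u = ((3 * int k + 3) * int ms - (us + int k)) * (ur + int k) + int ms * wr"
  note alg = cohn_step_algebra[OF wr(2) ws(2) z mz' m'', folded u_def]
  have nz: "int mr \<noteq> 0" "int ms \<noteq> 0" using mpos by auto
  define w where "w = ((3 * int k + 3) * us - ws) * (ur + int k) + us * wr"
  have "mtranspose (farey_matrix k (pr + ps, qr + qs)) = (int m, u, u + int k, w)"
    unfolding farey_matrix_mediant[OF det pos] wr(1) ws(1) joint_matrix_def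
    using alg(1,2)[OF nz] by (auto simp: u_def w_def algebra_simps)
  then have fm: "farey_matrix k (pr + ps, qr + qs) = (int m, u + int k, u, w)"
    by (metis mtranspose.simps mtranspose_mtranspose)
  then have "cohn_entries k (pr + ps, qr + qs) m u"
    unfolding cohn_entries_def using farey_matrix_det[of k "(pr + ps, qr + qs)"]
    by (auto simp: algebra_simps)
  moreover note alg(3,4)[OF nz]
  moreover have "0 < int mr * u"
  proof -
    have "0 \<le> int m * (ur + int k)" using bounds by simp
    then show ?thesis using alg(3)[OF nz] mpos by linarith
  qed
  then have "0 < u" using mpos by (simp add: zero_less_mult_iff)
  moreover have "int ms * (u + int k) < int ms * int m"
  proof -
    have "int m * us \<le> int m * int ms" using bounds by (intro mult_left_mono) auto
    then show ?thesis using alg(4)[OF nz] mpos mult.commute[of "int m" "int ms"] by linarith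
  qed
  then have "u + int k < int m" using mpos by simp
  ultimately show ?thesis using that by blast
qed

text \<open>A left child continues the pair \<open>(r, t)\<close> and a right child the pair
  \<open>(t, s)\<close>; each of the two relations provides the value \<open>z\<close> for one of
  them. Positivity of \<open>s\<close> keeps 1/0 out.\<close>

definition cohn_triple :: "nat \<Rightarrow> fraction \<times> fraction \<times> fraction \<Rightarrow> nat \<times> nat \<times> nat \<Rightarrow> bool" where
  "cohn_triple k v m \<longleftrightarrow> (case (v, m) of ((r, t, s), (mr, mt, ms)) \<Rightarrow>
     0 < fst s \<and> 0 < snd s \<and>
     (\<exists>ur ut us. cohn_entries k r mr ur \<and> cohn_entries k t mt ut \<and> cohn_entries k s ms us \<and>
       int mr * ut - int mt * (ur + int k) = int ms \<and> int mt * us - int ms * (ut + int k) = int mr \<and>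
       - int k \<le> ur \<and> 0 < ut \<and> ut + int k < int mt \<and> us \<le> int ms))"

lemma cohn_tripleI:
  assumes "0 < fst s" "0 < snd s" "cohn_entries k r mr ur" "cohn_entries k t mt ut"
    "cohn_entries k s ms us" "int mr * ut - int mt * (ur + int k) = int ms"
    "int mt * us - int ms * (ut + int k) = int mr" "- int k \<le> ur" "0 < ut" "ut + int k < int mt"
    "us \<le> int ms"
  shows "cohn_triple k (r, t, s) (mr, mt, ms)"
  using assms unfolding cohn_triple_def by auto

lemma cohn_entries_zero: "cohn_entries k (0, 1) 1 (- int k)"
  by (simp add: cohn_entries_def farey_matrix_def)

text \<open>The only diagonal is the central edge, so all its \<open>k\<close> signs come from the
  tie.\<close>

lemma cohn_entries_one: "cohn_entries k (1, 1) (k + 2) 1"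
  by (simp add: cohn_entries_def farey_matrix_def snake_word_def inner_word_def
      diagonal_signs_def side_sign_def word_matrix_append word_matrix_replicate_Minus)

lemma cohn_triple_left_subtree: "cohn_triple k (farey_vertex (L_child # w)) (markov_vertex k (L_child # w))"
proof (induction w rule: rev_induct)
  case Nil
  \<comment> \<open>Here \<open>z = 1\<close> is the entry of the Markov root at 1/0. Only this
    number is needed, no matrix: the relation reads \<open>1 * 1 - (k + 2) * 0 = 1\<close>.\<close>
  have eq: "1\<^sup>2 + (k + 2)\<^sup>2 + 1\<^sup>2 + k * (1 * (k + 2) + (k + 2) * 1 + 1 * 1) = (3 + 3 * k) * 1 * (k + 2) * 1"
    by (simp add: power2_eq_square algebra_simps)
  define m where "m = (1\<^sup>2 + k * 1 * (k + 2) + (k + 2)\<^sup>2) div 1"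
  obtain u where u: "cohn_entries k (0 + 1, 1 + 1) m u" "int 1 * u - int m * (- int k + int k) = int (k + 2)"
      "int m * 1 - int (k + 2) * (u + int k) = int 1" "0 < u" "u + int k < int m"
    by (rule cohn_entries_mediant[OF _ _ _ cohn_entries_zero cohn_entries_one _ eq, folded m_def]) auto
  have "cohn_triple k ((0, 1), (0 + 1, 1 + 1), (1, 1)) (1, m, k + 2)"
    by (rule cohn_tripleI[OF _ _ cohn_entries_zero u(1) cohn_entries_one u(2,3) _ u(4,5)]) auto
  then show ?case
    by (simp add: farey_vertex_def markov_vertex_def farey_root_def markov_root_def mediant_def m_def)
next
  case (snoc d w)
  obtain a b e f where v: "farey_vertex (L_child # w) = ((a, b), (a + e, b + f), (e, f))" "e * b = a * f + 1"
    using farey_vertex_form by blast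
  obtain mr mt ms where m: "markov_vertex k (L_child # w) = (mr, mt, ms)"
    by (cases "markov_vertex k (L_child # w)")
  have pos: "0 < mr" "0 < mt" "0 < ms"
    and eq: "mr\<^sup>2 + mt\<^sup>2 + ms\<^sup>2 + k * (mr * mt + mt * ms + ms * mr) = (3 + 3 * k) * mr * mt * ms"
    using markov_vertex_equation[of k "L_child # w"] m by auto
  have eq': "mt\<^sup>2 + ms\<^sup>2 + mr\<^sup>2 + k * (mt * ms + ms * mr + mr * mt) = (3 + 3 * k) * mt * ms * mr"
    using eq by (simp add: ac_simps)
  obtain ur ut us where u: "0 < e" "0 < f"
     "cohn_entries k (a, b) mr ur" "cohn_entries k (a + e, b + f) mt ut" "cohn_entries k (e, f) ms us"
     "int mr * ut - int mt * (ur + int k) = int ms" "int mt * us - int ms * (ut + int k) = int mr"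
     "- int k \<le> ur" "0 < ut" "ut + int k < int mt" "us \<le> int ms"
    using snoc v m unfolding cohn_triple_def by auto
  have fv: "farey_vertex (L_child # w @ [d]) = farey_child d ((a, b), (a + e, b + f), (e, f))"
    using v(1) by (simp add: farey_vertex_def)
  have mv: "markov_vertex k (L_child # w @ [d]) = markov_child k d (mr, mt, ms)"
    using m by (simp add: markov_vertex_def)
  show ?case
  proof (cases d)
    case L_child
    define m' where "m' = (mr\<^sup>2 + k * mr * mt + mt\<^sup>2) div ms"
    obtain u' where u': "cohn_entries k (a + (a + e), b + (b + f)) m' u'"
        "int mr * u' - int m' * (ur + int k) = int mt" "int m' * ut - int mt * (u' + int k) = int mr"
        "0 < u'" "u' + int k < int m'"
      by (rule cohn_entries_mediant[OF _ _ _ u(3,4,6) eq pos u(8), folded m'_def])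
        (use v u in \<open>auto simp: algebra_simps\<close>)
    have "cohn_triple k ((a, b), (a + (a + e), b + (b + f)), (a + e, b + f)) (mr, m', mt)"
      by (rule cohn_tripleI[OF _ _ u(3) u'(1) u(4) u'(2,3) u(8) u'(4,5)]) (use u in auto)
    then show ?thesis
      unfolding fv mv unfolding L_child by (simp add: mediant_def m'_def)
  next
    case R_child
    define m' where "m' = (mt\<^sup>2 + k * mt * ms + ms\<^sup>2) div mr"
    obtain u' where u': "cohn_entries k ((a + e) + e, (b + f) + f) m' u'"
        "int mt * u' - int m' * (ut + int k) = int ms" "int m' * us - int ms * (u' + int k) = int mt"
        "0 < u'" "u' + int k < int m'"
      by (rule cohn_entries_mediant[OF _ _ _ u(4,5,7) eq' pos(2,3,1) _ u(11), folded m'_def])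
        (use v u in \<open>auto simp: algebra_simps\<close>)
    have "cohn_triple k ((a + e, b + f), ((a + e) + e, (b + f) + f), (e, f)) (mt, m', ms)"
      by (rule cohn_tripleI[OF _ _ u(4) u'(1) u(5) u'(2,3) _ u'(4,5)]) (use u in auto)
    then show ?thesis
      unfolding fv mv unfolding R_child by (simp add: mediant_def m'_def)
  qed
qed

section \<open>Coprimality of adjacent Markov numbers\<close>

lemma coprime_quadratic:
  fixes a b c d k :: nat
  assumes "coprime a b" "d * c = a\<^sup>2 + k * a * b + b\<^sup>2"
  shows "coprime a d" "coprime d b"
proof -
  have "gcd a (d * c) = gcd a ((a + k * b) * a + b\<^sup>2)"
    unfolding assms(2) by (simp add: power2_eq_square algebra_simps)
  also have "\<dots> = gcd a (b\<^sup>2)" by (rule gcd_add_mult)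
  also have "\<dots> = 1" using assms(1) by simp
  finally have "coprime a (d * c)" by (simp add: coprime_iff_gcd_eq_1)
  then show "coprime a d" by simp
  have "gcd b (d * c) = gcd b ((b + k * a) * b + a\<^sup>2)"
    unfolding assms(2) by (simp add: power2_eq_square algebra_simps)
  also have "\<dots> = gcd b (a\<^sup>2)" by (rule gcd_add_mult)
  also have "\<dots> = 1" using assms(1) by (simp add: coprime_iff_gcd_eq_1[symmetric] coprime_commute)
  finally have "coprime b (d * c)" by (simp add: coprime_iff_gcd_eq_1)
  then show "coprime d b" by (simp add: coprime_commute)
qed

text \<open>This makes the left entry invertible modulo the middle one, so that the congruence for
  \<open>u_plus\<close> has at most one solution in range.\<close>

lemma markov_vertex_coprime:
  "case markov_vertex k w of (a, b, c) \<Rightarrow> coprime a b \<and> coprime b c"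
proof (induction w rule: rev_induct)
  case Nil
  show ?case by (simp add: markov_vertex_def markov_root_def)
next
  case (snoc d w)
  obtain a b c where v: "markov_vertex k w = (a, b, c)"
    by (cases "markov_vertex k w")
  then have child: "markov_vertex k (w @ [d]) = markov_child k d (a, b, c)"
    by (simp add: markov_vertex_def)
  note ex = markov_vertex_exact[OF v]
  have "coprime a b" "coprime b c" using snoc v by auto
  then show ?case
    using coprime_quadratic[of a b "(a\<^sup>2 + k * a * b + b\<^sup>2) div c" c k]
      coprime_quadratic[of b c "(b\<^sup>2 + k * b * c + c\<^sup>2) div a" a k] ex child
    by (cases d) auto
qed

section \<open>Locating a fraction in the Farey tree\<close>

lemma farey_vertex_exists:
  assumes "e * b = a * f + 1"
  shows "\<exists>w. farey_vertex w = ((a, b), (a + e, b + f), (e, f))"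
  using assms
proof (induction "a + b + e + f" arbitrary: a b e f rule: less_induct)
  case less
  have snoc: "farey_vertex (w @ [d]) = farey_child d (farey_vertex w)" for w d
    by (simp add: farey_vertex_def)
  have e: "0 < e" and b: "0 < b" using less.prems by (auto intro: Nat.gr0I)
  \<comment> \<open>Undoing the last step of a path subtracts one outer fraction from the other
    componentwise. Of the two mixed comparisons, one leaves only the root and the other contradicts
    the determinant.\<close>
  consider "e \<le> a" "f \<le> b" | "a \<le> e" "b \<le> f" | "a < e" "f < b" | "e < a" "b < f" by linarith
  then show ?case
  proof cases
    case 1
    then obtain a' b' where ab: "a = a' + e" "b = b' + f"
      by (metis add.commute le_add_diff_inverse)
    then obtain w where "farey_vertex w = ((a', b'), (a' + e, b' + f), (e, f))"
      using less.hyps[of a' b' e f] less.prems e by (auto simp: algebra_simps)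
    then have "farey_vertex (w @ [R_child]) = ((a, b), (a + e, b + f), (e, f))"
      by (simp add: snoc ab mediant_def)
    then show ?thesis by blast
  next
    case 2
    then obtain e' f' where ef: "e = a + e'" "f = b + f'"
      by (metis le_add_diff_inverse)
    then obtain w where "farey_vertex w = ((a, b), (a + e', b + f'), (e', f'))"
      using less.hyps[of a b e' f'] less.prems b by (auto simp: algebra_simps)
    then have "farey_vertex (w @ [L_child]) = ((a, b), (a + e, b + f), (e, f))"
      by (simp add: snoc ef mediant_def)
    then show ?thesis by blast
  next
    case 3
    then obtain x y where xy: "e = a + Suc x" "b = f + Suc y"
      by (metis add_Suc_right less_iff_Suc_add)
    have "a = 0 \<and> f = 0 \<and> x = 0 \<and> y = 0"
      using less.prems unfolding xy by (simp add: algebra_simps)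
    then have "farey_vertex [] = ((a, b), (a + e, b + f), (e, f))"
      using xy by (simp add: farey_vertex_def farey_root_def)
    then show ?thesis by blast
  next
    case 4
    then have "e * b \<le> a * f" by (intro mult_le_mono) auto
    then show ?thesis using less.prems by simp
  qed
qed

text \<open>The left neighbour solves a linear equation with coefficients from the middle fraction,
  so two solutions have denominators congruent modulo \<open>q\<close>. Both lie between 1 and
  \<open>q\<close>, hence they coincide.\<close>

lemma farey_middle_unique:
  assumes "farey_vertex v = (r, t, s)" "farey_vertex w = (r', t, s')"
  shows "r = r' \<and> s = s'"
proof -
  obtain a b e f where 1: "farey_vertex v = ((a, b), (a + e, b + f), (e, f))" "e * b = a * f + 1"
    using farey_vertex_form by blast
  obtain a' b' e' f' where 2: "farey_vertex w = ((a', b'), (a' + e', b' + f'), (e', f'))" "e' * b' = a' * f' + 1"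
    using farey_vertex_form by blast
  have t: "a + e = a' + e'" "b + f = b' + f'" using 1 2 assms by auto
  define p q where "p = int a + int e" and "q = int b + int f"
  have p': "p = int a' + int e'" and q': "q = int b' + int f'" using t by (auto simp: p_def q_def)
  have b: "0 < b" "0 < b'" using 1(2) 2(2) by (auto intro: Nat.gr0I)
  have d: "p * int b = q * int a + 1" "p * int b' = q * int a' + 1"
    subgoal using arg_cong[OF 1(2), of int] by (simp add: p_def q_def algebra_simps)
    subgoal using arg_cong[OF 2(2), of int] by (simp add: p' q' algebra_simps)
    done
  have "p * (int b - int b') = q * (int a - int a')" using d by (simp add: algebra_simps)
  then have "q dvd p * (int b - int b')" by simp
  moreover have "coprime p q"
    using d(1) by (metis coprimeI dvd_add_right_iff dvd_mult2 dvd_mult)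
  ultimately have "q dvd int b - int b'" by (simp add: coprime_commute coprime_dvd_mult_right_iff)
  moreover have "\<bar>int b - int b'\<bar> < q" using b q' q_def by auto
  ultimately have "int b = int b'" by (metis dvd_imp_le_int abs_of_pos eq_iff_diff_eq_0 linorder_not_le abs_ge_zero order_le_less_trans)
  moreover have "q * int a = q * int a'" using calculation d by (metis add_right_cancel)
  then have "a = a'" using b q_def by auto
  ultimately show ?thesis using 1 2 assms t by auto
qed

lemma right_subtree_ge_one:
  "case farey_vertex (R_child # w) of (r, t, s) \<Rightarrow> snd r \<le> fst r \<and> snd t \<le> fst t \<and> snd s \<le> fst s"
proof (induction w rule: rev_induct)
  case Nil
  show ?case by (simp add: farey_vertex_def farey_root_def mediant_def)
next
  case (snoc d w)
  obtain r t s where v: "farey_vertex (R_child # w) = (r, t, s)" by (cases "farey_vertex (R_child # w)")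
  then have "farey_vertex (R_child # w @ [d]) = farey_child d (r, t, s)"
    by (simp add: farey_vertex_def)
  with v snoc show ?case by (cases d) (auto simp: mediant_def)
qed

lemma farey_triple_left_subtree:
  assumes "0 < a" "a < b" "coprime a b"
  obtains w r s where "farey_vertex (L_child # w) = (r, (a, b), s)" "farey_triple (a, b) = (r, (a, b), s)"
proof -
  obtain q p where qp: "a * q = b * p + 1"
    using coprime_bezout_strong[of a b] assms by auto
  \<comment> \<open>The left neighbour of the fraction is the Bezout solution with
    \<open>0 < q' < b\<close>. The truncated subtraction is exact by the fact \<open>le\<close>
    below.\<close>
  define q' p' where "q' = q mod b" and "p' = p - a * (q div b)"
  have q: "q = b * (q div b) + q'" by (simp add: q'_def)
  have b1: "1 < b" using assms by simp
  have "b * (a * (q div b)) + a * q' = b * p + 1"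
    using qp q by (metis distrib_left mult.left_commute)
  have "q' \<noteq> 0"
  proof
    assume "q' = 0"
    then have "b dvd a * q" using q by (metis add.right_neutral dvd_triv_left dvd_mult)
    then have "b dvd 1" using qp by (metis dvd_add_right_iff dvd_triv_left)
    then show False using b1 by simp
  qed
  have "b * (a * (q div b)) < b * Suc p"
    using \<open>b * (a * (q div b)) + a * q' = b * p + 1\<close> b1 by simp
  then have le: "a * (q div b) \<le> p" by (simp only: mult_less_cancel1 less_Suc_eq_le)
  then have "p = a * (q div b) + p'" by (simp add: p'_def)
  then have e: "a * q' = b * p' + 1"
    using \<open>b * (a * (q div b)) + a * q' = b * p + 1\<close> by (simp add: distrib_left)
  have q'b: "q' < b" using b1 by (simp add: q'_def)
  have "b * p' < b * a"
  proof -
    have "a * q' < a * b" using q'b assms by simp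
    then show ?thesis using e mult.commute[of a b] by linarith
  qed
  then have p'a: "p' < a" by simp
  have "(a - p') * q' = p' * (b - q') + 1"
  proof -
    have "int ((a - p') * q') = int (p' * (b - q') + 1)"
      using arg_cong[OF e, of int] p'a q'b by (simp add: of_nat_diff algebra_simps)
    then show ?thesis by (simp only: of_nat_eq_iff)
  qed
  then obtain v where v: "farey_vertex v = ((p', q'), (a, b), (a - p', b - q'))"
    using farey_vertex_exists[of "a - p'" q' p' "b - q'"] p'a q'b by auto
  moreover obtain w where "v = L_child # w"
  proof (cases v)
    case Nil
    then show ?thesis using v assms by (simp add: farey_vertex_def farey_root_def)
  next
    case (Cons d w)
    then show ?thesis
      using that right_subtree_ge_one[of w] v assms by (cases d) auto
  qed
  moreover have "farey_triple (a, b) = farey_vertex v"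
    unfolding farey_triple_def
  proof (rule the_equality)
    show "farey_vertex v \<in> farey_tree \<and> fst (snd (farey_vertex v)) = (a, b)"
      using v by (metis farey_tree_def fst_conv rangeI snd_conv)
  next
    fix x assume x: "x \<in> farey_tree \<and> fst (snd x) = (a, b)"
    then obtain v' where v': "x = farey_vertex v'" by (auto simp: farey_tree_def)
    obtain r s where rs: "x = (r, (a, b), s)" using x by (cases x) auto
    show "x = farey_vertex v"
      using farey_middle_unique[of v' r "(a, b)" s v] v v' rs by simp
  qed
  ultimately show ?thesis using that by metis
qed

lemma snake_word_cfrac:
  assumes "0 < a" "a < b" "coprime a b"
  shows "cfrac_value (block_lengths (snake_word Minus k a (a + b))) =
    real (markov_number k (a, b)) / real (u_plus k (a, b))"
proof -
  obtain w r s where w: "farey_vertex (L_child # w) = (r, (a, b), s)" "farey_triple (a, b) = (r, (a, b), s)"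
    using farey_triple_left_subtree[OF assms] .
  obtain mr mt ms where m: "markov_vertex k (L_child # w) = (mr, mt, ms)"
    by (cases "markov_vertex k (L_child # w)")
  have th: "theta k (farey_triple (a, b)) = (mr, mt, ms)"
    using theta_farey_vertex[of k "L_child # w"] w m by simp
  obtain ur ut where u: "cohn_entries k (a, b) mt ut"
     "int mr * ut - int mt * (ur + int k) = int ms" "0 < ut" "ut + int k < int mt"
    using cohn_triple_left_subtree[of k w] w m unfolding cohn_triple_def by auto
  have cop: "coprime mr mt" using markov_vertex_coprime[of k "L_child # w"] m by simp
  have cong: "[mr * nat ut = ms] (mod mt)"
  proof -
    have "[int mr * ut = int ms] (mod int mt)"
      using u(2) by (metis cong_iff_lin diff_add_cancel add.commute cong_sym)
    then have "[int (mr * nat ut) = int ms] (mod int mt)" using u(3) by simp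
    then show ?thesis by (simp only: cong_int_iff)
  qed
  have "u_plus k (a, b) = nat ut"
    unfolding u_plus_def th prod.case
  proof (rule the_equality)
    show "0 < nat ut \<and> nat ut < mt \<and> [mr * nat ut = ms] (mod mt)"
      using u cong by auto
  next
    fix x assume x: "0 < x \<and> x < mt \<and> [mr * x = ms] (mod mt)"
    then have "[mr * x = mr * nat ut] (mod mt)" using cong by (meson cong_sym cong_trans)
    then have "[x = nat ut] (mod mt)" using cop by (simp add: cong_mult_lcancel_nat)
    then show "x = nat ut"
      using x u by (intro cong_less_modulus_unique_nat) auto
  qed
  moreover have "markov_number k (a, b) = mt"
    by (simp add: markov_number_def th)
  moreover obtain w' where "word_matrix (snake_word Minus k a (a + b)) = (int mt, ut + int k, ut, w')"
    using u(1) assms by (auto simp: cohn_entries_def farey_matrix_def)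
  then have "cfrac_value (block_lengths (snake_word Minus k a (a + b))) = real_of_int (int mt) / real_of_int ut"
    using cfrac_value_block_lengths[of "snake_word Minus k a (a + b)"] by (simp add: snake_word_def)
  ultimately show ?thesis using u(3) by simp
qed

section \<open>Sections of a triangle by a half-plane\<close>

lemma not_in_convex_hull_if_less:
  fixes g :: "'a::real_vector \<Rightarrow> real"
  assumes "linear g" "\<And>x. x \<in> S \<Longrightarrow> g x < g z"
  shows "z \<notin> convex hull S"
proof
  assume "z \<in> convex hull S"
  moreover have "convex hull S \<subseteq> g -` {..<g z}"
    using assms by (intro hull_minimal convex_linear_vimage) auto
  ultimately show False by auto
qed

text \<open>With a single vertex strictly above the line, the section is the triangle on
  \<open>P\<close> and the zeros \<open>Q'\<close>, \<open>R'\<close> of \<open>h\<close> on the two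
  sides at \<open>P\<close>, so there are at most three extreme points. A vertex \<open>Q\<close> on
  the line is its own \<open>Q'\<close>.\<close>

lemma triangle_Int_halfspace_not_quadrilateral:
  fixes h :: "point \<Rightarrow> real"
  assumes h: "linear h" and P: "0 < h P" and Q: "h Q \<le> 0" and R: "h R \<le> 0"
  shows "\<not> is_quadrilateral (convex hull {P, Q, R} \<inter> {x. 0 \<le> h x})"
proof -
  note hs = linear_add[OF h] linear_diff[OF h] linear_scale[OF h]
  define q r where "q = h P / (h P - h Q)" and "r = h P / (h P - h R)"
  have q: "0 < q" "q \<le> 1" and r: "0 < r" "r \<le> 1"
    using P Q R by (auto simp: q_def r_def field_simps)
  define Q' R' where "Q' = P + q *\<^sub>R (Q - P)" and "R' = P + r *\<^sub>R (R - P)"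
  have Q': "Q - P = (1 / q) *\<^sub>R (Q' - P)" and R': "R - P = (1 / r) *\<^sub>R (R' - P)"
    using q r by (auto simp: Q'_def R'_def)
  have h0: "h Q' = 0" "h R' = 0"
    using P Q R by (auto simp: Q'_def R'_def hs q_def r_def field_simps)
  let ?S = "convex hull {P, Q, R} \<inter> {x. 0 \<le> h x}"
  have "?S = convex hull {P, Q', R'}"
  proof (intro subset_antisym subsetI)
    fix X assume X: "X \<in> ?S"
    then obtain u v where uv: "X = P + u *\<^sub>R (Q - P) + v *\<^sub>R (R - P)" "0 \<le> u" "0 \<le> v" "u + v \<le> 1"
      by (auto simp: convex_hull_3_alt)
    \<comment> \<open>In coordinates rescaled by \<open>1 / q\<close> and \<open>1 / r\<close>,
      nonnegativity of \<open>h X\<close> says precisely that they sum to at most 1.\<close>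
    have "0 \<le> h P - u * (h P - h Q) - v * (h P - h R)"
      using X by (simp add: uv(1) hs algebra_simps)
    then have "0 \<le> (h P - u * (h P - h Q) - v * (h P - h R)) / h P" using P by simp
    also have "\<dots> = 1 - u / q - v / r"
      using P Q R by (simp add: q_def r_def field_simps)
    finally have "u / q + v / r \<le> 1" by simp
    moreover have "X = P + (u / q) *\<^sub>R (Q' - P) + (v / r) *\<^sub>R (R' - P)"
      unfolding uv(1) Q' R' by simp
    moreover have "0 \<le> u / q" "0 \<le> v / r" using uv q r by auto
    ultimately show "X \<in> convex hull {P, Q', R'}"
      unfolding convex_hull_3_alt by blast
  next
    have "convex ?S"
      using convex_linear_vimage[OF h, of "{0..}"]
      by (intro convex_Int convex_convex_hull) (simp add: vimage_def)
    moreover have "Q' \<in> convex hull {P, Q, R}"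
    proof -
      have "Q' = P + q *\<^sub>R (Q - P) + 0 *\<^sub>R (R - P) \<and> 0 \<le> q \<and> 0 \<le> (0 :: real) \<and> q + 0 \<le> 1"
        using q by (simp add: Q'_def)
      then show ?thesis unfolding convex_hull_3_alt by blast
    qed
    moreover have "R' \<in> convex hull {P, Q, R}"
    proof -
      have "R' = P + 0 *\<^sub>R (Q - P) + r *\<^sub>R (R - P) \<and> 0 \<le> (0 :: real) \<and> 0 \<le> r \<and> 0 + r \<le> 1"
        using r by (simp add: R'_def)
      then show ?thesis unfolding convex_hull_3_alt by blast
    qed
    moreover have "P \<in> convex hull {P, Q, R}" by (simp add: hull_inc)
    ultimately have "convex hull {P, Q', R'} \<subseteq> ?S"
      using P h0 by (intro hull_minimal) auto
    then show "X \<in> ?S" if "X \<in> convex hull {P, Q', R'}" for X using that by blast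
  qed
  then have "{p. p extreme_point_of ?S} \<subseteq> {P, Q', R'}"
    using extreme_points_of_convex_hull by metis
  then have "card {p. p extreme_point_of ?S} \<le> card {P, Q', R'}"
    by (intro card_mono) auto
  also have "\<dots> \<le> 3" by (simp add: card_insert_if)
  finally show ?thesis by (simp add: is_quadrilateral_def)
qed

text \<open>The functionals \<open>\<phi>\<close> and \<open>\<psi>\<close> are, up to constants,
  the barycentric coordinates belonging to \<open>Q\<close> and \<open>R\<close>. They separate each
  of \<open>Q\<close>, \<open>R\<close>, \<open>Q'\<close>, \<open>R'\<close> from the hull of the
  other three.\<close>

lemma triangle_Int_halfspace_quadrilateral:
  fixes h \<phi> \<psi> :: "point \<Rightarrow> real"
  assumes h: "linear h" and P: "h P < 0" and Q: "0 < h Q" and R: "0 < h R"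
    and lin: "linear \<phi>" "linear \<psi>"
    and \<phi>: "\<phi> Q = \<phi> P + 1" "\<phi> R = \<phi> P" and \<psi>: "\<psi> Q = \<psi> P" "\<psi> R = \<psi> P + 1"
  shows "is_quadrilateral (convex hull {P, Q, R} \<inter> {x. 0 \<le> h x})"
proof -
  note hs = linear_add[OF h] linear_diff[OF h] linear_scale[OF h]
  note \<phi>s = linear_add[OF lin(1)] linear_diff[OF lin(1)] linear_scale[OF lin(1)]
  note \<psi>s = linear_add[OF lin(2)] linear_diff[OF lin(2)] linear_scale[OF lin(2)]
  define q r where "q = - h P / (h Q - h P)" and "r = - h P / (h R - h P)"
  have q: "0 < q" "q < 1" and r: "0 < r" "r < 1"
    using P Q R by (auto simp: q_def r_def field_simps)
  define Q' R' where "Q' = P + q *\<^sub>R (Q - P)" and "R' = P + r *\<^sub>R (R - P)"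
  have h0: "h Q' = 0" "h R' = 0"
    using P Q R by (auto simp: Q'_def R'_def hs q_def r_def field_simps)
  have \<phi>': "\<phi> Q' = \<phi> P + q" "\<phi> R' = \<phi> P" and \<psi>': "\<psi> Q' = \<psi> P" "\<psi> R' = \<psi> P + r"
    by (simp_all add: Q'_def R'_def \<phi>s \<psi>s \<phi> \<psi>)
  let ?S = "convex hull {P, Q, R} \<inter> {x. 0 \<le> h x}" and ?V = "{Q, R, Q', R'}"
  let ?H = "convex hull ?V"
  have S: "?S = ?H"
  proof (intro subset_antisym subsetI)
    fix X assume X: "X \<in> ?S"
    then obtain u v where uv: "X = P + u *\<^sub>R (Q - P) + v *\<^sub>R (R - P)" "0 \<le> u" "0 \<le> v" "u + v \<le> 1"
      by (auto simp: convex_hull_3_alt)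
    \<comment> \<open>The ray from \<open>P\<close> through \<open>X = P + V\<close> crosses the
      segment from \<open>Q'\<close> to \<open>R'\<close> at parameter \<open>\<tau>\<close> and
      that from \<open>Q\<close> to \<open>R\<close> at \<open>1 / w\<close>. As \<open>X\<close>
      has parameter 1, it lies between the two.\<close>
    define V where "V = u *\<^sub>R (Q - P) + v *\<^sub>R (R - P)"
    define w D \<tau> where "w = u + v" and "D = u * (h Q - h P) + v * (h R - h P)" and "\<tau> = - h P / D"
    have "h X = h P + D"
      by (simp add: uv(1) hs D_def)
    then have D: "- h P \<le> D" using X by simp
    then have D0: "0 < D" using P by simp
    have w: "0 < w"
    proof (rule ccontr)
      assume "\<not> 0 < w"
      then have "u = 0" "v = 0" using uv by (auto simp: w_def)
      then show False using D0 by (simp add: D_def)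
    qed
    have \<tau>: "\<tau> \<le> 1" using D D0 by (simp add: \<tau>_def field_simps)
    have "P + (1 / w) *\<^sub>R V = (u / w) *\<^sub>R Q + (v / w) *\<^sub>R R"
    proof -
      have "u / w + v / w = 1" using w by (simp add: w_def flip: add_divide_distrib)
      then have "P = (u / w) *\<^sub>R P + (v / w) *\<^sub>R P" by (metis scaleR_left_distrib scaleR_one)
      then show ?thesis by (simp add: V_def algebra_simps)
    qed
    moreover have "(u / w) *\<^sub>R Q + (v / w) *\<^sub>R R \<in> ?H"
      using uv w by (intro convexD convex_convex_hull) (auto simp: hull_inc w_def simp flip: add_divide_distrib)
    ultimately have B: "P + (1 / w) *\<^sub>R V \<in> ?H" by simp
    define \<alpha> \<beta> where "\<alpha> = u * (h Q - h P) / D" and "\<beta> = v * (h R - h P) / D"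
    have \<alpha>\<beta>: "\<alpha> + \<beta> = 1" "0 \<le> \<alpha>" "0 \<le> \<beta>"
      using D0 uv P Q R by (auto simp: \<alpha>_def \<beta>_def D_def simp flip: add_divide_distrib)
    have "\<alpha> * q = \<tau> * u" "\<beta> * r = \<tau> * v"
      using P Q R by (auto simp: \<alpha>_def \<beta>_def \<tau>_def q_def r_def)
    then have "P + \<tau> *\<^sub>R V = P + \<alpha> *\<^sub>R (Q' - P) + \<beta> *\<^sub>R (R' - P)"
      by (simp add: V_def Q'_def R'_def scaleR_right_distrib)
    also have "\<dots> = (\<alpha> + \<beta>) *\<^sub>R P + \<alpha> *\<^sub>R (Q' - P) + \<beta> *\<^sub>R (R' - P)" using \<alpha>\<beta> by simp
    also have "\<dots> = \<alpha> *\<^sub>R Q' + \<beta> *\<^sub>R R'" by (simp add: algebra_simps)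
    also have "\<dots> \<in> ?H"
      using \<alpha>\<beta> by (intro convexD convex_convex_hull) (auto simp: hull_inc)
    finally have A: "P + \<tau> *\<^sub>R V \<in> ?H" .
    have X': "X = P + V" by (simp add: uv(1) V_def)
    show "X \<in> ?H"
    proof (cases "w = 1")
      case True
      then show ?thesis using B X' by simp
    next
      case False
      then have "1 < 1 / w" using w uv by (simp add: w_def)
      then have pos: "0 < 1 / w - \<tau>" using \<tau> by simp
      define l where "l = (1 - \<tau>) / (1 / w - \<tau>)"
      have l: "0 \<le> l" "l \<le> 1" using pos \<tau> \<open>1 < 1 / w\<close> by (auto simp: l_def)
      have "\<tau> + l * (1 / w - \<tau>) = 1" using pos by (simp add: l_def)
      then have one: "(1 - l) * \<tau> + l * (1 / w) = 1" by (simp add: algebra_simps)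
      have "(1 - l) *\<^sub>R (P + \<tau> *\<^sub>R V) + l *\<^sub>R (P + (1 / w) *\<^sub>R V) = P + ((1 - l) * \<tau> + l * (1 / w)) *\<^sub>R V"
        by (simp add: algebra_simps)
      also have "\<dots> = X" by (simp only: one X' scaleR_one)
      finally show ?thesis
        using convexD[OF convex_convex_hull A B, of "1 - l" l] l by simp
    qed
  next
    have "convex ?S"
      using convex_linear_vimage[OF h, of "{0..}"]
      by (intro convex_Int convex_convex_hull) (simp add: vimage_def)
    moreover have "Q' \<in> convex hull {P, Q, R}"
    proof -
      have "Q' = P + q *\<^sub>R (Q - P) + 0 *\<^sub>R (R - P) \<and> 0 \<le> q \<and> 0 \<le> (0 :: real) \<and> q + 0 \<le> 1"
        using q by (simp add: Q'_def)
      then show ?thesis unfolding convex_hull_3_alt by blast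
    qed
    moreover have "R' \<in> convex hull {P, Q, R}"
    proof -
      have "R' = P + 0 *\<^sub>R (Q - P) + r *\<^sub>R (R - P) \<and> 0 \<le> (0 :: real) \<and> 0 \<le> r \<and> 0 + r \<le> 1"
        using r by (simp add: R'_def)
      then show ?thesis unfolding convex_hull_3_alt by blast
    qed
    ultimately have "?H \<subseteq> ?S"
      using Q R h0 by (intro hull_minimal) (auto simp: hull_inc)
    then show "X \<in> ?S" if "X \<in> ?H" for X using that by blast
  qed
  have "z \<notin> convex hull (?V - {z})" if "z \<in> ?V" for z
  proof -
    \<comment> \<open>In coordinates with \<open>P\<close> at the origin, \<open>Q'\<close> is
      \<open>(q, 0)\<close> and \<open>R'\<close> is \<open>(0, r)\<close>. As \<open>q\<close> and
      \<open>r\<close> are below 1, the first functional is largest at \<open>Q'\<close> alone and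
      the second at \<open>R'\<close> alone.\<close>
    have "linear (\<lambda>x. - (\<phi> x + \<psi> x / r))" "linear (\<lambda>x. - (\<phi> x / q + \<psi> x))"
      by (rule linearI; simp add: \<phi>s \<psi>s add_divide_distrib algebra_simps)+
    note lins = lin this
    consider "z = Q" | "z = R" | "z = Q'" | "z = R'" using \<open>z \<in> ?V\<close> by blast
    then show ?thesis
    proof cases
      case 1
      show ?thesis by (rule not_in_convex_hull_if_less[OF lins(1)]) (use 1 q \<phi> \<phi>' in auto)
    next
      case 2
      show ?thesis by (rule not_in_convex_hull_if_less[OF lins(2)]) (use 2 r \<psi> \<psi>' in auto)
    next
      case 3
      have r1: "1 < 1 / r" using r by simp
      have val: "\<psi> R / r = \<psi> P / r + 1 / r" "\<psi> R' / r = \<psi> P / r + 1"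
        using r by (simp_all add: \<psi> \<psi>' add_divide_distrib)
      show ?thesis
      proof (rule not_in_convex_hull_if_less[OF lins(3)])
        fix x assume "x \<in> ?V - {z}"
        then have "x = Q \<or> x = R \<or> x = R'" using 3 by blast
        then show "- (\<phi> x + \<psi> x / r) < - (\<phi> z + \<psi> z / r)"
          unfolding 3 using val r1 q \<phi> \<phi>' \<psi>(1) \<psi>'(1) by (elim disjE; hypsubst) simp_all
      qed
    next
      case 4
      have q1: "1 < 1 / q" using q by simp
      have val: "\<phi> Q / q = \<phi> P / q + 1 / q" "\<phi> Q' / q = \<phi> P / q + 1"
        using q by (simp_all add: \<phi> \<phi>' add_divide_distrib)
      show ?thesis
      proof (rule not_in_convex_hull_if_less[OF lins(4)])
        fix x assume "x \<in> ?V - {z}"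
        then have "x = Q \<or> x = R \<or> x = Q'" using 4 by blast
        then show "- (\<phi> x / q + \<psi> x) < - (\<phi> z / q + \<psi> z)"
          unfolding 4 using val q1 r \<phi>(2) \<phi>'(2) \<psi> \<psi>' by (elim disjE; hypsubst) simp_all
      qed
    qed
  qed
  then have "{p. p extreme_point_of ?H} = ?V"
    using extreme_point_of_convex_hull_convex_independent[of ?V] by (auto simp: finite_imp_compact)
  moreover have "card ?V = 4"
  proof -
    have "Q \<noteq> R" "Q \<noteq> Q'" "Q \<noteq> R'" "R \<noteq> Q'" "R \<noteq> R'" "Q' \<noteq> R'"
      using \<phi> \<phi>' \<psi> \<psi>' q r by auto
    then show ?thesis by simp
  qed
  moreover have "polytope ?H" by (intro polytope_convex_hull) simp
  ultimately show ?thesis unfolding S is_quadrilateral_def by simp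
qed

section \<open>The cells met by the segment\<close>

lemma low_triangle_iff:
  "(x, y) \<in> convex hull {lattice_point i j, lattice_point (i + 1) j, lattice_point i (j + 1)} \<longleftrightarrow>
     of_int i \<le> x \<and> of_int j \<le> y \<and> x + y \<le> of_int i + of_int j + 1"
    (is "_ \<in> convex hull {?P, ?Q, ?R} \<longleftrightarrow> ?rhs")
proof
  assume "(x, y) \<in> convex hull {?P, ?Q, ?R}"
  then show ?rhs unfolding convex_hull_3_alt lattice_point_def by auto
next
  assume ?rhs
  then have "(x, y) = ?P + (x - of_int i) *\<^sub>R (?Q - ?P) + (y - of_int j) *\<^sub>R (?R - ?P) \<and>
      0 \<le> x - of_int i \<and> 0 \<le> y - of_int j \<and> (x - of_int i) + (y - of_int j) \<le> 1"
    by (simp add: lattice_point_def)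
  then show "(x, y) \<in> convex hull {?P, ?Q, ?R}" unfolding convex_hull_3_alt by blast
qed

lemma up_triangle_iff:
  "(x, y) \<in> convex hull {lattice_point (i + 1) (j + 1), lattice_point i (j + 1), lattice_point (i + 1) j} \<longleftrightarrow>
     x \<le> of_int i + 1 \<and> y \<le> of_int j + 1 \<and> of_int i + of_int j + 1 \<le> x + y"
    (is "_ \<in> convex hull {?P, ?Q, ?R} \<longleftrightarrow> ?rhs")
proof
  assume "(x, y) \<in> convex hull {?P, ?Q, ?R}"
  then show ?rhs unfolding convex_hull_3_alt lattice_point_def by auto
next
  assume ?rhs
  then have "(x, y) = ?P + (of_int i + 1 - x) *\<^sub>R (?Q - ?P) + (of_int j + 1 - y) *\<^sub>R (?R - ?P) \<and>
      0 \<le> of_int i + 1 - x \<and> 0 \<le> of_int j + 1 - y \<and> (of_int i + 1 - x) + (of_int j + 1 - y) \<le> 1"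
    by (simp add: lattice_point_def)
  then show "(x, y) \<in> convex hull {?P, ?Q, ?R}" unfolding convex_hull_3_alt by blast
qed

lemma diagonal_edge_iff:
  "(x, y) \<in> closed_segment (lattice_point i (j + 1)) (lattice_point (i + 1) j) \<longleftrightarrow>
     of_int i \<le> x \<and> x \<le> of_int i + 1 \<and> x + y = of_int i + of_int j + 1" (is "?l \<longleftrightarrow> ?r")
proof -
  have "?l \<longleftrightarrow> (\<exists>u. 0 \<le> u \<and> u \<le> 1 \<and> x = of_int i + u \<and> y = of_int j + 1 - u)"
    by (simp add: in_segment lattice_point_def algebra_simps)
  also have "\<dots> \<longleftrightarrow> ?r" by (rule iffI) (auto intro!: exI[of _ "x - of_int i"])
  finally show ?thesis .
qed

lemma horizontal_edge_iff:
  "(x, y) \<in> closed_segment (lattice_point i j) (lattice_point (i + 1) j) \<longleftrightarrow>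
     of_int i \<le> x \<and> x \<le> of_int i + 1 \<and> y = of_int j" (is "?l \<longleftrightarrow> ?r")
proof -
  have "?l \<longleftrightarrow> (\<exists>u. 0 \<le> u \<and> u \<le> 1 \<and> x = of_int i + u \<and> y = of_int j)"
    by (simp add: in_segment lattice_point_def algebra_simps)
  also have "\<dots> \<longleftrightarrow> ?r" by (rule iffI) (auto intro!: exI[of _ "x - of_int i"])
  finally show ?thesis .
qed

lemma vertical_edge_iff:
  "(x, y) \<in> closed_segment (lattice_point i j) (lattice_point i (j + 1)) \<longleftrightarrow>
     of_int j \<le> y \<and> y \<le> of_int j + 1 \<and> x = of_int i" (is "?l \<longleftrightarrow> ?r")
proof -
  have "?l \<longleftrightarrow> (\<exists>u. 0 \<le> u \<and> u \<le> 1 \<and> y = of_int j + u \<and> x = of_int i)"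
    by (simp add: in_segment lattice_point_def algebra_simps) auto
  also have "\<dots> \<longleftrightarrow> ?r" by (rule iffI) (auto intro!: exI[of _ "y - of_int j"])
  finally show ?thesis .
qed

locale snake =
  fixes a b :: nat
  assumes pos: "0 < a" "0 < b" and coprime_ab: "coprime a b" and large: "2 < a + b"
begin

text \<open>The \<open>d\<close>-th square met by the segment is the one with lower left corner \<open>(I d, J d)\<close>; its diagonal
  lies on the line \<open>x + y = d\<close>.\<close>

definition c :: nat where "c = a + b"
definition y :: "nat \<Rightarrow> nat" where "y d = d * a mod c"
definition J :: "nat \<Rightarrow> int" where "J d = int (d * a div c)"
definition I :: "nat \<Rightarrow> int" where "I d = int d - 1 - J d"

definition pt :: "real \<Rightarrow> point" where "pt s = (s * real b, s * real a)"

lemma c_gt: "2 < c" using large by (simp add: c_def)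

lemma coprime_ac: "coprime a c"
  using coprime_ab by (simp add: c_def coprime_iff_gcd_eq_1)

lemma y_pos: "0 < d \<Longrightarrow> d < c \<Longrightarrow> 0 < y d"
  unfolding y_def using mult_mod_pos[OF coprime_ac] .

lemma y_less: "y d < c"
  using c_gt by (simp add: y_def)

lemma y_J: "int d * int a = int c * J d + int (y d)"
  unfolding J_def y_def by (metis mult_div_mod_eq of_nat_add of_nat_mult)

lemma J_one: "J 1 = 0"
  using pos by (simp add: J_def c_def)

text \<open>The residue can grow by \<open>a\<close> without reaching \<open>c\<close> just when it
  is below \<open>b\<close>. Otherwise it wraps, losing \<open>c - a = b\<close>, and the quotient
  \<open>J\<close> grows: the segment climbs into the next row.\<close>

lemma y_Suc_vertical: "y d < b \<Longrightarrow> y (Suc d) = y d + a"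
  and J_Suc_vertical: "y d < b \<Longrightarrow> J (Suc d) = J d"
proof -
  assume "y d < b"
  have *: "Suc d * a = (y d + a) + c * (d * a div c)"
    unfolding y_def by (metis add.commute add.left_commute mult_Suc mult_div_mod_eq)
  have lt: "y d + a < c" using \<open>y d < b\<close> by (simp add: c_def)
  show "y (Suc d) = y d + a"
    unfolding y_def[of "Suc d"] * using lt by (simp only: mod_mult_self2 mod_less)
  show "J (Suc d) = J d"
    unfolding J_def * using lt by simp
qed

lemma y_Suc_horizontal: "b \<le> y d \<Longrightarrow> y (Suc d) = y d - b"
  and J_Suc_horizontal: "b \<le> y d \<Longrightarrow> J (Suc d) = J d + 1"
proof -
  assume "b \<le> y d"
  then have *: "Suc d * a = (y d - b) + c * (d * a div c + 1)"
    unfolding y_def by (simp add: c_def)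
  have lt: "y d - b < c" using y_less[of d] by simp
  show "y (Suc d) = y d - b"
    unfolding y_def[of "Suc d"] * using lt by (simp only: mod_mult_self2 mod_less)
  show "J (Suc d) = J d + 1"
    unfolding J_def * using lt by (subst div_mult_self2) auto
qed

lemma y_last: "y (c - 1) = b"
  using mult_mod_complement[OF coprime_ac, of 1] c_gt pos by (simp add: y_def c_def)

lemma height_lattice:
  "real b * of_int (J d) - real a * of_int (I d) = real a - real (y d)"
proof -
  have "int b * J d - int a * I d = int a - int (y d)"
    using y_J[of d] by (simp add: I_def c_def algebra_simps)
  then show ?thesis by (metis of_int_diff of_int_mult of_int_of_nat_eq)
qed

lemma I_real: "real_of_int (I d) = real d - 1 - of_int (J d)"
  by (simp add: I_def)

lemma c_real: "real c = real a + real b"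
  by (simp add: c_def)

lemma c_pos: "0 < real c"
  using c_gt by simp

text \<open>At parameter \<open>d / c\<close> the segment crosses the line \<open>x + y = d\<close>.
  The residue is neither 0 nor \<open>c\<close>, so the crossing point is interior to the
  square.\<close>

lemma square_bounds:
  assumes "0 < d" "d < c"
  shows "of_int (J d) / real a < d / c" "d / c < (of_int (J d) + 1) / real a"
    "of_int (I d) / real b < d / c" "d / c < (of_int (I d) + 1) / real b"
    "0 \<le> J d" "0 \<le> I d" "J d < int a" "I d < int b"
proof -
  have yy: "0 < real (y d)" "real (y d) < real c" using y_pos[OF assms] y_less[of d] by auto
  have eq: "real d * real a = real c * of_int (J d) + real (y d)"
    using arg_cong[OF y_J[of d], of real_of_int] by simp
  have eq2: "real d * real b = real c * of_int (I d) + (real c - real (y d))"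
    using eq by (simp add: I_real c_real algebra_simps)
  show 1: "of_int (J d) / real a < d / c" "d / c < (of_int (J d) + 1) / real a"
    "of_int (I d) / real b < d / c" "d / c < (of_int (I d) + 1) / real b"
    using eq eq2 yy pos c_gt by (auto simp: field_simps)
  show "0 \<le> J d" by (simp add: J_def)
  have d: "0 < real d / real c" "real d / real c < 1" using assms by auto
  have "0 < (of_int (I d) + 1) / real b" using 1 d by linarith
  then show "0 \<le> I d" using pos by (simp add: zero_less_divide_iff)
  have "of_int (J d) / real a < 1" "of_int (I d) / real b < 1" using 1 d by linarith+
  then show "J d < int a" "I d < int b" using pos by (simp_all add: field_simps)
qed

lemma square_bounds_mult:
  assumes "0 < d" "d < c"
  shows "of_int (J d) < d / c * real a" "d / c * real a < of_int (J d) + 1"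
    "of_int (I d) < d / c * real b" "d / c * real b < of_int (I d) + 1"
proof -
  have "0 < real a" "0 < real b" using pos by auto
  note * = pos_divide_less_eq[OF this(1)] pos_divide_less_eq[OF this(2)]
    pos_less_divide_eq[OF this(1)] pos_less_divide_eq[OF this(2)]
  show "of_int (J d) < d / c * real a" "d / c * real a < of_int (J d) + 1"
    "of_int (I d) < d / c * real b" "d / c * real b < of_int (I d) + 1"
    using square_bounds(1-4)[OF assms] unfolding * .
qed

section \<open>Parameter intervals of triangles and edges\<close>

definition low :: "nat \<Rightarrow> cell" where
  "low d = Triangle (lattice_point (I d) (J d)) (lattice_point (I d + 1) (J d)) (lattice_point (I d) (J d + 1))"

definition up :: "nat \<Rightarrow> cell" where
  "up d = Triangle (lattice_point (I d + 1) (J d + 1)) (lattice_point (I d) (J d + 1)) (lattice_point (I d + 1) (J d))"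

definition dia :: "nat \<Rightarrow> cell" where
  "dia d = Edge (lattice_point (I d) (J d + 1)) (lattice_point (I d + 1) (J d))"

definition side :: "nat \<Rightarrow> cell" where
  "side d = (if y d < b then Edge (lattice_point (I d + 1) (J d)) (lattice_point (I d + 1) (J d + 1))
     else Edge (lattice_point (I d) (J d + 1)) (lattice_point (I d + 1) (J d + 1)))"

definition entry :: "nat \<Rightarrow> real" where
  "entry d = max (of_int (I d) / real b) (of_int (J d) / real a)"

text \<open>Pulled back along the segment, cells become intervals, and \<open>precedes\<close>
  compares these since the abscissa grows with the parameter.\<close>

definition params :: "cell \<Rightarrow> real set" where
  "params x = {s. 0 \<le> s \<and> s \<le> 1 \<and> pt s \<in> cell_set x}"

definition lo :: "cell \<Rightarrow> real" where "lo x = Inf (params x)"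
definition hi :: "cell \<Rightarrow> real" where "hi x = Sup (params x)"

lemma line_segment_eq: "line_segment (a, b) = pt ` {0..1}"
  by (auto simp: line_segment_def endpoint_def closed_segment_def pt_def image_iff algebra_simps)

lemma open_segment_eq: "open_segment (0, 0) (endpoint (a, b)) = pt ` {0<..<1}"
proof -
  have "(0, 0) \<noteq> endpoint (a, b)" using pos by (simp add: endpoint_def)
  then show ?thesis
    by (auto simp: in_segment endpoint_def pt_def image_iff algebra_simps)
qed

lemma precedes_iff: "precedes (a, b) x z \<longleftrightarrow> (\<forall>s \<in> params x. \<forall>s' \<in> params z. s \<le> s')"
proof -
  have *: "p \<in> cell_set x \<inter> line_segment (a, b) \<longleftrightarrow> (\<exists>s \<in> params x. p = pt s)" for x p
    by (auto simp: line_segment_eq params_def)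
  have "fst (pt s) \<le> fst (pt s') \<longleftrightarrow> s \<le> s'" for s s'
    using pos by (simp add: pt_def)
  then show ?thesis unfolding precedes_def Ball_def * by blast
qed

lemma entry_less: "0 < d \<Longrightarrow> d < c \<Longrightarrow> entry d < d / c"
  using square_bounds[of d] by (simp add: entry_def)

lemma entry_nonneg: "0 < d \<Longrightarrow> d < c \<Longrightarrow> 0 \<le> entry d"
  using square_bounds[of d] by (simp add: entry_def le_max_iff_disj)

lemma params_low:
  assumes "0 < d" "d < c"
  shows "params (low d) = {entry d..d / c}"
proof -
  have "s \<in> params (low d) \<longleftrightarrow> s \<in> {entry d..d / c}" for s
  proof -
    have "d / c \<le> 1" using assms by simp
    moreover note entry_nonneg[OF assms]
    moreover have "pt s \<in> cell_set (low d) \<longleftrightarrow> entry d \<le> s \<and> s \<le> d / c"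
      unfolding low_def pt_def cell_set.simps low_triangle_iff
      using pos c_pos by (auto simp: entry_def divide_le_eq le_divide_eq I_real c_real algebra_simps)
    ultimately show ?thesis unfolding params_def by auto
  qed
  then show ?thesis by blast
qed

definition exit :: "nat \<Rightarrow> real" where
  "exit d = min ((of_int (I d) + 1) / real b) ((of_int (J d) + 1) / real a)"

lemma exit_greater: "0 < d \<Longrightarrow> d < c \<Longrightarrow> d / c < exit d"
  using square_bounds[of d] by (simp add: exit_def)

lemma exit_le: "0 < d \<Longrightarrow> d < c \<Longrightarrow> exit d \<le> 1"
proof -
  assume "0 < d" "d < c"
  then have "I d + 1 \<le> int b" using square_bounds(8)[of d] by simp
  then have "of_int (I d) + 1 \<le> real b" by linarith
  then show ?thesis using pos by (simp add: exit_def min_le_iff_disj)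
qed

lemma params_up:
  assumes "0 < d" "d < c"
  shows "params (up d) = {d / c..exit d}"
proof -
  have "s \<in> params (up d) \<longleftrightarrow> s \<in> {d / c..exit d}" for s
  proof -
    have "0 \<le> s" if "d / c \<le> s" using that by (rule order_trans[rotated]) simp
    moreover note exit_le[OF assms]
    moreover have "pt s \<in> cell_set (up d) \<longleftrightarrow> d / c \<le> s \<and> s \<le> exit d"
      unfolding up_def pt_def cell_set.simps up_triangle_iff
      using pos c_pos by (auto simp: exit_def divide_le_eq le_divide_eq I_real c_real algebra_simps)
    ultimately show ?thesis unfolding params_def by auto
  qed
  then show ?thesis by blast
qed

lemma params_dia:
  assumes "0 < d" "d < c"
  shows "params (dia d) = {d / c}"
proof -
  have "s \<in> params (dia d) \<longleftrightarrow> s = d / c" for s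
  proof -
    have "0 \<le> d / c" "d / c \<le> 1" using assms by simp_all
    moreover have "s * real b + s * real a = of_int (I d) + of_int (J d) + 1 \<longleftrightarrow> s = d / c"
      using c_pos by (simp add: I_real c_real eq_divide_eq algebra_simps)
    moreover have "of_int (I d) \<le> d / c * real b" "d / c * real b \<le> of_int (I d) + 1"
      using square_bounds[OF assms] pos by (simp_all add: field_simps)
    ultimately show ?thesis unfolding params_def by (auto simp: dia_def pt_def diagonal_edge_iff)
  qed
  then show ?thesis by blast
qed

text \<open>Both are the parameter of the side between the two squares. The interior points at
  \<open>d / c\<close> and \<open>Suc d / c\<close> decide which terms of the minimum and the
  maximum count.\<close>

lemma exit_eq_entry:
  assumes "0 < d" "Suc d < c"
  shows "exit d = entry (Suc d)"
proof -
  note 1 = square_bounds[of d] and 2 = square_bounds[of "Suc d"]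
  show ?thesis
  proof (cases "y d < b")
    case True
    then have "J (Suc d) = J d" "I (Suc d) = I d + 1" by (simp_all add: J_Suc_vertical I_def)
    then show ?thesis using 1 2 assms by (simp add: exit_def entry_def)
  next
    case False
    then have "J (Suc d) = J d + 1" "I (Suc d) = I d" by (simp_all add: J_Suc_horizontal I_def)
    then show ?thesis using 1 2 assms by (simp add: exit_def entry_def)
  qed
qed

lemma exit_bounds:
  assumes "0 < d" "d < c"
  shows "of_int (I d) \<le> exit d * real b" "exit d * real b \<le> of_int (I d) + 1"
    "of_int (J d) \<le> exit d * real a" "exit d * real a \<le> of_int (J d) + 1"
proof -
  have "of_int (I d) / real b \<le> exit d" "of_int (J d) / real a \<le> exit d"
    using square_bounds(1,3)[OF assms] exit_greater[OF assms] by linarith+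
  moreover have "exit d \<le> (of_int (I d) + 1) / real b" "exit d \<le> (of_int (J d) + 1) / real a"
    by (simp_all add: exit_def)
  ultimately show "of_int (I d) \<le> exit d * real b" "exit d * real b \<le> of_int (I d) + 1"
    "of_int (J d) \<le> exit d * real a" "exit d * real a \<le> of_int (J d) + 1"
    using pos by (simp_all add: divide_le_eq le_divide_eq)
qed

lemma params_side:
  assumes "0 < d" "Suc d < c"
  shows "params (side d) = {exit d}"
proof -
  note 2 = square_bounds[of "Suc d"]
  have d: "0 < d" "d < c" using assms by auto
  have "0 \<le> d / c" by simp
  then have e: "0 \<le> exit d" "exit d \<le> 1"
    using exit_le[OF d] exit_greater[OF d] by linarith+
  have "s \<in> params (side d) \<longleftrightarrow> s = exit d" for s
  proof (cases "y d < b")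
    case True
    then have "J (Suc d) = J d" "I (Suc d) = I d + 1" by (simp_all add: J_Suc_vertical I_def)
    then have ex: "exit d = (of_int (I d) + 1) / real b"
      using 2 assms by (simp add: exit_def)
    have "s * real b = of_int (I d) + 1 \<longleftrightarrow> s = exit d"
      unfolding ex using pos by (simp add: field_simps)
    then show ?thesis
      using True e exit_bounds[OF d] unfolding params_def by (auto simp: side_def pt_def vertical_edge_iff)
  next
    case False
    then have "J (Suc d) = J d + 1" "I (Suc d) = I d" by (simp_all add: J_Suc_horizontal I_def)
    then have ex: "exit d = (of_int (J d) + 1) / real a"
      using 2 assms by (simp add: exit_def)
    have "s * real a = of_int (J d) + 1 \<longleftrightarrow> s = exit d"
      unfolding ex using pos by (simp add: field_simps)
    then show ?thesis
      using False e exit_bounds[OF d] unfolding params_def by (auto simp: side_def pt_def horizontal_edge_iff)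
  qed
  then show ?thesis by blast
qed

lemmas params_cells = params_low params_up params_dia params_side

lemma lo_hi:
  assumes "0 < d" "d < c"
  shows "lo (low d) = entry d" "hi (low d) = d / c" "lo (up d) = d / c" "hi (up d) = exit d"
    "lo (dia d) = d / c" "hi (dia d) = d / c"
    "Suc d < c \<Longrightarrow> lo (side d) = exit d" "Suc d < c \<Longrightarrow> hi (side d) = exit d"
  using entry_less[OF assms] exit_greater[OF assms] assms
  by (simp_all add: lo_def hi_def params_cells)

section \<open>Order of the cells along the segment\<close>

definition prefix_cells :: "nat \<Rightarrow> cell list" where
  "prefix_cells n = concat (map (\<lambda>d. [low d, dia d, up d, side d]) [1..<n])"

definition cells :: "cell list" where
  "cells = prefix_cells (c - 1) @ [low (c - 1), dia (c - 1), up (c - 1)]"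

text \<open>The second condition makes the relation strict: cells are linearly ordered by the sum of the
  end points of their parameter intervals, which identifies \<open>passed_cells\<close>.\<close>

definition before :: "cell \<Rightarrow> cell \<Rightarrow> bool" where
  "before x z \<longleftrightarrow> hi x \<le> lo z \<and> lo x + hi x < lo z + hi z"

lemma block_bounds:
  assumes d: "0 < d" "d < c"
  shows "sorted_wrt before [low d, dia d, up d]"
    "z \<in> {low d, dia d, up d} \<Longrightarrow> entry d \<le> lo z \<and> 2 * entry d < lo z + hi z \<and> hi z \<le> exit d \<and> lo z + hi z < 2 * exit d"
    "Suc d < c \<Longrightarrow> lo (side d) = exit d \<and> hi (side d) = exit d"
    "entry d < exit d"
proof -
  note 1 = entry_less[OF d] exit_greater[OF d]
  show "sorted_wrt before [low d, dia d, up d]"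
    using 1 by (simp add: before_def lo_hi[OF d])
  show "entry d \<le> lo z \<and> 2 * entry d < lo z + hi z \<and> hi z \<le> exit d \<and> lo z + hi z < 2 * exit d"
    if "z \<in> {low d, dia d, up d}"
  proof -
    have "z = low d \<or> z = dia d \<or> z = up d" using that by blast
    then show ?thesis using 1 by (elim disjE; hypsubst) (simp_all only: lo_hi[OF d], linarith+)
  qed
  show "Suc d < c \<Longrightarrow> lo (side d) = exit d \<and> hi (side d) = exit d" using lo_hi[OF d] by simp
  show "entry d < exit d" using 1 by linarith
qed

lemma sorted_prefix_append:
  assumes "sorted_wrt before xs" "\<forall>x \<in> set xs. hi x \<le> entry d \<and> lo x + hi x \<le> 2 * entry d"
    and d: "0 < d" "d < c"
  shows "sorted_wrt before (xs @ [low d, dia d, up d])"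
    "x \<in> set (xs @ [low d, dia d, up d]) \<Longrightarrow> hi x \<le> exit d \<and> lo x + hi x < 2 * exit d"
proof -
  have "before x z" if "x \<in> set xs" "z \<in> {low d, dia d, up d}" for x z
  proof -
    have "hi x \<le> entry d" "lo x + hi x \<le> 2 * entry d" using assms(2) that(1) by auto
    moreover have "entry d \<le> lo z" "2 * entry d < lo z + hi z" using block_bounds(2)[OF d that(2)] by auto
    ultimately show ?thesis unfolding before_def by linarith
  qed
  then show "sorted_wrt before (xs @ [low d, dia d, up d])"
    using assms(1) block_bounds(1)[OF d] unfolding sorted_wrt_append by simp
  show "hi x \<le> exit d \<and> lo x + hi x < 2 * exit d" if "x \<in> set (xs @ [low d, dia d, up d])"
  proof (cases "x \<in> set xs")
    case True
    then have "hi x \<le> entry d" "lo x + hi x \<le> 2 * entry d" using assms(2) by auto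
    then show ?thesis using block_bounds(4)[OF d] by linarith
  next
    case False
    then have "x \<in> {low d, dia d, up d}" using that by auto
    from block_bounds(2)[OF d this] show ?thesis by blast
  qed
qed

lemma sorted_prefix:
  assumes "1 \<le> n" "n < c"
  shows "sorted_wrt before (prefix_cells n) \<and>
    (\<forall>x \<in> set (prefix_cells n). hi x \<le> entry n \<and> lo x + hi x \<le> 2 * entry n)"
  using assms
proof (induction n rule: dec_induct)
  case base
  then show ?case by (simp add: prefix_cells_def)
next
  case (step n)
  have n: "0 < n" "n < c" "Suc n < c" using step.prems step.hyps by auto
  let ?xs = "prefix_cells n @ [low n, dia n, up n]"
  have split: "prefix_cells (Suc n) = ?xs @ [side n]"
    using step.hyps by (simp add: prefix_cells_def)
  note IH = step.IH[OF n(2)]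
  note A = sorted_prefix_append[OF conjunct1[OF IH] conjunct2[OF IH] n(1,2)]
  have side: "lo (side n) = exit n" "hi (side n) = exit n" using block_bounds(3)[OF n(1,2,3)] by auto
  have ex: "exit n = entry (Suc n)" using exit_eq_entry[OF n(1,3)] .
  have "before x (side n)" if "x \<in> set ?xs" for x
    using A(2)[OF that] unfolding before_def side by linarith
  then have "sorted_wrt before (prefix_cells (Suc n))"
    using A(1) unfolding split sorted_wrt_append[of _ ?xs] by simp
  moreover have "hi x \<le> entry (Suc n) \<and> lo x + hi x \<le> 2 * entry (Suc n)" if "x \<in> set (prefix_cells (Suc n))" for x
  proof (cases "x = side n")
    case True
    then show ?thesis using side ex by simp
  next
    case False
    then have "x \<in> set ?xs" using that unfolding split by auto
    from A(2)[OF this] show ?thesis unfolding ex by linarith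
  qed
  ultimately show ?case by blast
qed

lemma sorted_cells: "sorted_wrt before cells"
proof -
  have n: "0 < c - 1" "c - 1 < c" and n': "1 \<le> c - 1" using c_gt by auto
  note IH = sorted_prefix[OF n' n(2)]
  show ?thesis
    unfolding cells_def using sorted_prefix_append(1)[OF conjunct1[OF IH] conjunct2[OF IH] n] .
qed

lemma set_cells:
  "set cells = low ` {1..<c} \<union> up ` {1..<c} \<union> (dia ` {1..<c} \<union> side ` {1..<c - 1})"
proof -
  have "{1..<c} = insert (c - 1) {1..<c - 1}" using c_gt by auto
  then show ?thesis by (auto simp: cells_def prefix_cells_def)
qed

lemma params_interval:
  assumes "x \<in> set cells"
  shows "params x = {lo x..hi x}" "lo x \<le> hi x"
proof -
  have "params x = {lo x..hi x} \<and> lo x \<le> hi x"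
    using assms unfolding set_cells
    by (auto simp: lo_hi params_cells Suc_le_eq less_imp_le[OF entry_less] less_imp_le[OF exit_greater])
  then show "params x = {lo x..hi x}" "lo x \<le> hi x" by auto
qed

lemma precedes_cells_iff:
  assumes "x \<in> set cells" "z \<in> set cells"
  shows "precedes (a, b) x z \<longleftrightarrow> hi x \<le> lo z"
proof
  note x = params_interval[OF assms(1)] and z = params_interval[OF assms(2)]
  have *: "hi x \<in> params x" "lo z \<in> params z"
    unfolding x(1) z(1) using x(2) z(2) by simp_all
  show "hi x \<le> lo z" if "precedes (a, b) x z" using that * unfolding precedes_iff by blast
  show "precedes (a, b) x z" if "hi x \<le> lo z"
    unfolding precedes_iff x(1) z(1)
  proof (intro ballI)
    fix s s' assume "s \<in> {lo x..hi x}" "s' \<in> {lo z..hi z}"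
    then have "s \<le> hi x" "lo z \<le> s'" by auto
    then show "s \<le> s'" using that by linarith
  qed
qed

section \<open>Squares and edges met by the segment\<close>

lemma no_lattice_point:
  assumes "0 < s" "s < 1" "s * real b = of_int m" "s * real a = of_int n"
  shows False
proof -
  have "of_int m * real a = of_int n * real b"
    unfolding assms(3,4)[symmetric] by (simp add: ac_simps)
  then have "real_of_int (m * int a) = real_of_int (n * int b)" by simp
  then have "m * int a = n * int b" by (simp only: of_int_eq_iff)
  then have "int b dvd m * int a" by simp
  then have "int b dvd m"
    using coprime_ab by (simp add: coprime_dvd_mult_left_iff coprime_commute)
  moreover have "0 < real_of_int m" "real_of_int m < real b"
    using assms pos by (auto simp flip: assms(3))
  then have "0 < m" "m < int b" by auto
  ultimately show False by (simp add: zdvd_not_zless)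
qed

lemma snake_squares_eq: "snake_squares (a, b) = (\<lambda>d. (I d, J d)) ` {1..<c}"
proof -
  have iff: "(i, j) \<in> snake_squares (a, b) \<longleftrightarrow> (\<exists>s. 0 \<le> s \<and> s \<le> 1 \<and>
      of_int i < s * real b \<and> s * real b < of_int i + 1 \<and> of_int j < s * real a \<and> s * real a < of_int j + 1)" for i j
  proof -
    have "(i, j) \<in> snake_squares (a, b) \<longleftrightarrow> (\<exists>s. 0 \<le> s \<and> s \<le> 1 \<and> pt s \<in> interior (unit_square i j))"
      unfolding snake_squares_def line_segment_eq by auto
    moreover have "pt s \<in> interior (unit_square i j) \<longleftrightarrow> of_int i < s * real b \<and> s * real b < of_int i + 1 \<and>
        of_int j < s * real a \<and> s * real a < of_int j + 1" for s
      by (auto simp: unit_square_def lattice_point_def cbox_Pair_eq interior_Times pt_def)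
    ultimately show ?thesis by simp
  qed
  show ?thesis
  proof (intro subset_antisym subsetI)
    fix p assume p: "p \<in> snake_squares (a, b)"
    obtain i j where ij: "p = (i, j)" by (cases p)
    obtain s where s: "0 \<le> s" "s \<le> 1" "of_int i < s * real b" "s * real b < of_int i + 1"
        "of_int j < s * real a" "s * real a < of_int j + 1"
      using p iff ij by blast
    have "0 \<le> s * real b" "0 \<le> s * real a" "s * real b \<le> real b" "s * real a \<le> real a"
      using s(1,2) by (auto simp: mult_left_le_one_le)
    then have ij0: "0 \<le> i" "0 \<le> j" "i < int b" "j < int a" using s by linarith+
    define d where "d = nat (i + j + 1)"
    have d: "int d = i + j + 1" "0 < d" "d < c" using ij0 by (auto simp: d_def c_def)
    have dr: "real d = of_int i + of_int j + 1" using arg_cong[OF d(1), of real_of_int] by simp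
    have "real d / real c * real b + real d / real c * real a = real d / real c * (real a + real b)"
      by (simp add: distrib_left)
    also have "\<dots> = real d" using c_pos by (simp flip: c_real)
    finally have dd: "real d / real c * real b + real d / real c * real a = real d" .
    \<comment> \<open>Towards the parameter \<open>d / c\<close> both coordinates move in the same
      direction. So the bounds on one side persist, and those on the other follow because the
      coordinates sum to \<open>i + j + 1\<close>.\<close>
    have "of_int j < real d / real c * real a \<and> real d / real c * real a < of_int j + 1"
    proof (cases "s \<le> d / c")
      case True
      then have "s * real a \<le> d / c * real a" "s * real b \<le> d / c * real b"
        by (intro mult_right_mono; simp)+
      then show ?thesis using s dd dr by linarith
    next
      case False
      then have "d / c * real a \<le> s * real a" "d / c * real b \<le> s * real b"
        by (intro mult_right_mono; simp)+
      then show ?thesis using s dd dr by linarith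
    qed
    moreover have "of_int (J d) < real d / real c * real a \<and> real d / real c * real a < of_int (J d) + 1"
      using square_bounds_mult[OF d(2,3)] by simp
    ultimately have "j = J d" by linarith
    moreover from this have "i = I d" using d(1) by (simp add: I_def)
    ultimately show "p \<in> (\<lambda>d. (I d, J d)) ` {1..<c}" using d ij by auto
  next
    fix p assume "p \<in> (\<lambda>d. (I d, J d)) ` {1..<c}"
    then obtain d where "d \<in> {1..<c}" and p: "p = (I d, J d)" by blast
    then have d: "0 < d" "d < c" by auto
    have "0 \<le> real d / real c" "real d / real c \<le> 1" using d by auto
    moreover have "of_int (I d) < d / c * real b" "d / c * real b < of_int (I d) + 1"
        "of_int (J d) < d / c * real a" "d / c * real a < of_int (J d) + 1"
      using square_bounds_mult[OF d] by simp_all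
    ultimately show "p \<in> snake_squares (a, b)" unfolding p iff by blast
  qed
qed

lemma snake_triangles_eq: "snake_triangles (a, b) = low ` {1..<c} \<union> up ` {1..<c}"
proof -
  have "snake_triangles (a, b) = (\<Union>d \<in> {1..<c}. {low d, up d})"
    unfolding snake_triangles_def snake_squares_eq low_def up_def by simp
  then show ?thesis by blast
qed

text \<open>No lattice point lies inside the segment, so the crossing comes strictly after the line
  \<open>x + y = d - 1\<close>. Hence the row grows between the squares \<open>d - 1\<close> and
  \<open>d\<close>, and the edge is the one through which the former is left.\<close>

lemma bottom_edge_crossed:
  assumes d: "0 < d" "d < c" and s: "0 < s" "s < 1"
    and e: "of_int (I d) \<le> s * real b" "s * real b \<le> of_int (I d) + 1" "s * real a = of_int (J d)"
  shows "Edge (lattice_point (I d) (J d)) (lattice_point (I d + 1) (J d)) \<in> side ` {1..<c - 1}"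
proof -
  have "s * real b \<noteq> of_int (I d)" "s * real b \<noteq> of_int (I d + 1)"
    using no_lattice_point[OF s _ e(3)] by blast+
  then have sc: "real d - 1 < s * real c"
    using e by (simp add: c_real I_real algebra_simps)
  have "0 < s * real a" using s pos by simp
  then have "0 < J d" using e by simp
  then have "1 < d" using square_bounds(6)[OF d] by (simp add: I_def)
  then obtain m where m: "d = Suc m" "0 < m" by (metis One_nat_def Suc_lessE less_trans_Suc zero_less_one)
  have "of_int (J m) / real a < m / c" using square_bounds[of m] m d by simp
  also have "m / c < s" using sc m c_pos by (simp add: divide_less_eq)
  also have "s = of_int (J d) / real a" using e pos by (simp add: eq_divide_eq)
  finally have "J m < J d" using pos by (simp add: divide_less_cancel)
  then have "b \<le> y m" using J_Suc_vertical[of m] m by force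
  moreover from this have "J d = J m + 1" "I d = I m"
    using J_Suc_horizontal[of m] m by (simp_all add: I_def)
  ultimately have "side m = Edge (lattice_point (I d) (J d)) (lattice_point (I d + 1) (J d))"
    by (simp add: side_def)
  moreover have "m \<in> {1..<c - 1}" using m d by auto
  ultimately show ?thesis by (metis imageI)
qed

lemma left_edge_crossed:
  assumes d: "0 < d" "d < c" and s: "0 < s" "s < 1"
    and e: "of_int (J d) \<le> s * real a" "s * real a \<le> of_int (J d) + 1" "s * real b = of_int (I d)"
  shows "Edge (lattice_point (I d) (J d)) (lattice_point (I d) (J d + 1)) \<in> side ` {1..<c - 1}"
proof -
  have "s * real a \<noteq> of_int (J d)" "s * real a \<noteq> of_int (J d + 1)"
    using no_lattice_point[OF s e(3)] by blast+
  then have sc: "real d - 1 < s * real c"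
    using e by (simp add: c_real I_real algebra_simps)
  have "0 < s * real b" using s pos by simp
  then have "0 < I d" using e by simp
  then have "1 < d" using square_bounds(5)[OF d] by (simp add: I_def)
  then obtain m where m: "d = Suc m" "0 < m" by (metis One_nat_def Suc_lessE less_trans_Suc zero_less_one)
  have "of_int (I m) / real b < m / c" using square_bounds[of m] m d by simp
  also have "m / c < s" using sc m c_pos by (simp add: divide_less_eq)
  also have "s = of_int (I d) / real b" using e pos by (simp add: eq_divide_eq)
  finally have "I m < I d" using pos by (simp add: divide_less_cancel)
  then have "y m < b" using J_Suc_horizontal[of m] m by (force simp: I_def)
  moreover from this have "J d = J m" "I d = I m + 1"
    using J_Suc_vertical[of m] m by (simp_all add: I_def)
  ultimately have "side m = Edge (lattice_point (I d) (J d)) (lattice_point (I d) (J d + 1))"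
    by (simp add: side_def)
  moreover have "m \<in> {1..<c - 1}" using m d by auto
  ultimately show ?thesis by (metis imageI)
qed

text \<open>The crossing comes strictly before the line \<open>x + y = d + 1\<close>, on which the
  segment is already in a higher row.\<close>

lemma top_edge_crossed:
  assumes d: "0 < d" "d < c" and s: "0 < s" "s < 1"
    and e: "of_int (I d) \<le> s * real b" "s * real b \<le> of_int (I d) + 1" "s * real a = of_int (J d) + 1"
  shows "Edge (lattice_point (I d) (J d + 1)) (lattice_point (I d + 1) (J d + 1)) \<in> side ` {1..<c - 1}"
proof -
  have e3: "s * real a = of_int (J d + 1)" using e by simp
  have "s * real b \<noteq> of_int (I d)" "s * real b \<noteq> of_int (I d + 1)"
    using no_lattice_point[OF s _ e3] by blast+
  then have sc: "s * real c < real d + 1"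
    using e by (simp add: c_real I_real algebra_simps)
  have "s * real a < real a" using s pos by simp
  then have "J d + 1 < int a" using e3 by linarith
  then have m: "Suc d < c" using square_bounds(8)[OF d] by (simp add: I_def c_def)
  have "s = (of_int (J d) + 1) / real a" using e pos by (simp add: eq_divide_eq)
  moreover have "s < Suc d / c" using sc c_pos by (simp add: less_divide_eq algebra_simps)
  moreover have "Suc d / c < (of_int (J (Suc d)) + 1) / real a" using square_bounds(2)[of "Suc d"] m by simp
  ultimately have "(of_int (J d) + 1) / real a < (of_int (J (Suc d)) + 1) / real a" by linarith
  then have "J d < J (Suc d)" using pos by (simp add: divide_less_cancel)
  then have "b \<le> y d" using J_Suc_vertical[of d] by force
  then show ?thesis using d m by (intro image_eqI[of _ _ d]) (auto simp: side_def)
qed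

lemma right_edge_crossed:
  assumes d: "0 < d" "d < c" and s: "0 < s" "s < 1"
    and e: "of_int (J d) \<le> s * real a" "s * real a \<le> of_int (J d) + 1" "s * real b = of_int (I d) + 1"
  shows "Edge (lattice_point (I d + 1) (J d)) (lattice_point (I d + 1) (J d + 1)) \<in> side ` {1..<c - 1}"
proof -
  have e3: "s * real b = of_int (I d + 1)" using e by simp
  have "s * real a \<noteq> of_int (J d)" "s * real a \<noteq> of_int (J d + 1)"
    using no_lattice_point[OF s e3] by blast+
  then have sc: "s * real c < real d + 1"
    using e by (simp add: c_real I_real algebra_simps)
  have "s * real b < real b" using s pos by simp
  then have "I d + 1 < int b" using e3 by linarith
  then have m: "Suc d < c" using square_bounds(7)[OF d] by (simp add: I_def c_def)
  have "s = (of_int (I d) + 1) / real b" using e pos by (simp add: eq_divide_eq)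
  moreover have "s < Suc d / c" using sc c_pos by (simp add: less_divide_eq algebra_simps)
  moreover have "Suc d / c < (of_int (I (Suc d)) + 1) / real b" using square_bounds(4)[of "Suc d"] m by simp
  ultimately have "(of_int (I d) + 1) / real b < (of_int (I (Suc d)) + 1) / real b" by linarith
  then have "I d < I (Suc d)" using pos by (simp add: divide_less_cancel)
  then have "y d < b" using J_Suc_horizontal[of d] by (force simp: I_def)
  then show ?thesis using d m by (intro image_eqI[of _ _ d]) (auto simp: side_def)
qed

lemma snake_edges_eq: "snake_edges (a, b) = (\<Union>d \<in> {1..<c}.
    {Edge (lattice_point (I d) (J d)) (lattice_point (I d + 1) (J d)),
      Edge (lattice_point (I d) (J d + 1)) (lattice_point (I d + 1) (J d + 1)),
      Edge (lattice_point (I d) (J d)) (lattice_point (I d) (J d + 1)),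
      Edge (lattice_point (I d + 1) (J d)) (lattice_point (I d + 1) (J d + 1)),
      Edge (lattice_point (I d) (J d + 1)) (lattice_point (I d + 1) (J d))})"
  unfolding snake_edges_def snake_squares_eq by simp

lemma crossed_edges_eq: "crossed_edges (a, b) = dia ` {1..<c} \<union> side ` {1..<c - 1}"
proof (intro subset_antisym subsetI)
  fix x assume "x \<in> crossed_edges (a, b)"
  then have "x \<in> snake_edges (a, b)" and "\<exists>s. 0 < s \<and> s < 1 \<and> pt s \<in> cell_set x"
    by (auto simp: crossed_edges_def open_segment_eq)
  then obtain d s where d: "0 < d" "d < c" and s: "0 < s" "s < 1" and x: "pt s \<in> cell_set x"
    and cases: "x \<in> {Edge (lattice_point (I d) (J d)) (lattice_point (I d + 1) (J d)),
      Edge (lattice_point (I d) (J d + 1)) (lattice_point (I d + 1) (J d + 1)),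
      Edge (lattice_point (I d) (J d)) (lattice_point (I d) (J d + 1)),
      Edge (lattice_point (I d + 1) (J d)) (lattice_point (I d + 1) (J d + 1)),
      Edge (lattice_point (I d) (J d + 1)) (lattice_point (I d + 1) (J d))}"
    unfolding snake_edges_eq UN_iff by (metis (no_types, lifting) atLeastLessThan_iff less_eq_Suc_le One_nat_def)
  have "x = dia d \<or> x \<in> side ` {1..<c - 1}"
    using cases
  proof (elim insertE emptyE)
    assume "x = Edge (lattice_point (I d) (J d)) (lattice_point (I d + 1) (J d))"
    with x bottom_edge_crossed[OF d s] show ?thesis by (simp only: cell_set.simps pt_def horizontal_edge_iff simp_thms)
  next
    assume "x = Edge (lattice_point (I d) (J d + 1)) (lattice_point (I d + 1) (J d + 1))"
    with x top_edge_crossed[OF d s] show ?thesis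
      by (simp only: cell_set.simps pt_def horizontal_edge_iff simp_thms of_int_add of_int_1)
  next
    assume "x = Edge (lattice_point (I d) (J d)) (lattice_point (I d) (J d + 1))"
    with x left_edge_crossed[OF d s] show ?thesis by (simp only: cell_set.simps pt_def vertical_edge_iff simp_thms)
  next
    assume "x = Edge (lattice_point (I d + 1) (J d)) (lattice_point (I d + 1) (J d + 1))"
    with x right_edge_crossed[OF d s] show ?thesis
      by (simp only: cell_set.simps pt_def vertical_edge_iff simp_thms of_int_add of_int_1)
  next
    assume "x = Edge (lattice_point (I d) (J d + 1)) (lattice_point (I d + 1) (J d))"
    then show ?thesis by (simp add: dia_def)
  qed
  then show "x \<in> dia ` {1..<c} \<union> side ` {1..<c - 1}" using d by auto
next
  have crossed: "x \<in> crossed_edges (a, b)" if "x \<in> snake_edges (a, b)" "s \<in> params x" "0 < s" "s < 1" for x s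
    using that unfolding crossed_edges_def open_segment_eq params_def by auto
  have "dia d \<in> crossed_edges (a, b)" if "d \<in> {1..<c}" for d
  proof (rule crossed[of _ "d / c"])
    show "dia d \<in> snake_edges (a, b)"
      unfolding snake_edges_eq UN_iff by (rule bexI[OF _ that]) (simp add: dia_def)
  qed (use that in \<open>auto simp: params_dia\<close>)
  moreover have "side d \<in> crossed_edges (a, b)" if "d \<in> {1..<c - 1}" for d
  proof (rule crossed[of _ "exit d"])
    have d: "0 < d" "d < c" "Suc d < c" "d \<in> {1..<c}" using that by auto
    show "side d \<in> snake_edges (a, b)"
      unfolding snake_edges_eq UN_iff by (rule bexI[OF _ d(4)]) (simp add: side_def)
    show "exit d \<in> params (side d)" using d by (simp add: params_side)
    have "0 < d / c" "Suc d / c < 1" using d by auto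
    then show "0 < exit d" "exit d < 1"
      using exit_greater[of d] exit_eq_entry[of d] entry_less[of "Suc d"] d by linarith+
  qed
  ultimately show "x \<in> crossed_edges (a, b)" if "x \<in> dia ` {1..<c} \<union> side ` {1..<c - 1}" for x
    using that by blast
qed

text \<open>In an arbitrary admissible list \<open>precedes\<close> orders the keys
  \<open>lo x + hi x\<close> only weakly, but the keys are injective on the cells, so just one list
  is sorted by them.\<close>

lemma passed_cells_eq: "passed_cells (a, b) = cells"
  unfolding passed_cells_def
proof (rule the_equality)
  have set: "set cells = snake_triangles (a, b) \<union> crossed_edges (a, b)"
    unfolding set_cells snake_triangles_eq crossed_edges_eq ..
  let ?key = "\<lambda>x. lo x + hi x"
  have strict: "sorted_wrt (\<lambda>x z. ?key x < ?key z) cells"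
    using sorted_cells by (rule sorted_wrt_mono_rel[rotated]) (simp add: before_def)
  then have "sorted_wrt (<) (map ?key cells)" by (simp add: sorted_wrt_map)
  then have dist: "sorted (map ?key cells) \<and> distinct (map ?key cells)"
    by (simp only: strict_sorted_iff)
  have "sorted_wrt (precedes (a, b)) cells"
    using sorted_cells by (rule sorted_wrt_mono_rel[rotated]) (simp add: before_def precedes_cells_iff)
  then show "distinct cells \<and> set cells = snake_triangles (a, b) \<union> crossed_edges (a, b) \<and>
      sorted_wrt (precedes (a, b)) cells"
    using dist set by (simp add: distinct_map)
  fix cs assume cs: "distinct cs \<and> set cs = snake_triangles (a, b) \<union> crossed_edges (a, b) \<and>
      sorted_wrt (precedes (a, b)) cs"
  then have eq: "set cs = set cells" using set by simp
  have "sorted_wrt (\<lambda>x z. ?key x \<le> ?key z) cs"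
  proof (rule sorted_wrt_mono_rel)
    show "sorted_wrt (precedes (a, b)) cs" using cs by simp
    fix x z assume xz: "x \<in> set cs" "z \<in> set cs" "precedes (a, b) x z"
    then have "hi x \<le> lo z" "lo x \<le> hi x" "lo z \<le> hi z"
      using precedes_cells_iff params_interval eq by auto
    then show "?key x \<le> ?key z" by linarith
  qed
  then have "sorted (map ?key cs)" by (simp add: sorted_wrt_map)
  moreover have inj: "inj_on ?key (set cells)" using dist by (simp add: distinct_map)
  then have "distinct (map ?key cs)" using cs eq by (simp add: distinct_map)
  ultimately have "map ?key cs = map ?key cells"
    using dist eq by (intro sorted_distinct_set_unique) auto
  then show "cs = cells" using inj eq by (simp add: inj_on_map_eq_map)
qed

section \<open>Heights of lattice points and signs of cells\<close>

definition height :: "point \<Rightarrow> real" where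
  "height p = real b * snd p - real a * fst p"

lemma linear_height: "linear height"
  unfolding height_def by (rule linearI; simp add: algebra_simps)

lemma on_or_above_eq: "on_or_above (a, b) = {p. 0 \<le> height p}"
  by (auto simp: on_or_above_def height_def)

lemma height_square:
  "height (lattice_point (I d) (J d)) = real a - real (y d)"
  "height (lattice_point (I d + 1) (J d)) = - real (y d)"
  "height (lattice_point (I d) (J d + 1)) = real c - real (y d)"
  "height (lattice_point (I d + 1) (J d + 1)) = real b - real (y d)"
proof -
  let ?h = "real b * of_int (J d) - real a * of_int (I d)"
  have "height (lattice_point (I d) (J d)) = ?h"
    "height (lattice_point (I d + 1) (J d)) = ?h - real a"
    "height (lattice_point (I d) (J d + 1)) = ?h + real b"
    "height (lattice_point (I d + 1) (J d + 1)) = ?h + real b - real a"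
    by (simp_all add: height_def lattice_point_def distrib_left)
  then show "height (lattice_point (I d) (J d)) = real a - real (y d)"
    "height (lattice_point (I d + 1) (J d)) = - real (y d)"
    "height (lattice_point (I d) (J d + 1)) = real c - real (y d)"
    "height (lattice_point (I d + 1) (J d + 1)) = real b - real (y d)"
    unfolding height_lattice c_real by simp_all
qed

lemma linear_coordinates:
  "linear (\<lambda>p :: point. fst p + snd p)" "linear (\<lambda>p :: point. - fst p - snd p)"
  "linear (\<lambda>p :: point. - fst p)" "linear (\<lambda>p :: point. snd p)"
  by (intro linear_compose_add linear_compose_sub linear_compose_neg linear_fst linear_snd)+

text \<open>The upper left corner is above the line and the lower right one below, so the third
  corner, at height \<open>a - y d\<close>, decides between the two kinds of section.\<close>

lemma low_quadrilateral_iff: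
  assumes d: "0 < d" "d < c" and ne: "y d \<noteq> a"
  shows "is_quadrilateral (cell_set (low d) \<inter> on_or_above (a, b)) \<longleftrightarrow> y d < a"
proof (cases "y d < a")
  case True
  have "is_quadrilateral (convex hull {lattice_point (I d + 1) (J d), lattice_point (I d) (J d), lattice_point (I d) (J d + 1)}
      \<inter> {p. 0 \<le> height p})"
    using True y_pos[OF d] y_less[of d]
    by (intro triangle_Int_halfspace_quadrilateral[OF linear_height _ _ _ linear_coordinates(2,4)])
      (simp_all only: height_square, simp_all add: lattice_point_def)
  with True show ?thesis by (simp add: low_def on_or_above_eq insert_commute)
next
  case False
  have "\<not> is_quadrilateral (convex hull {lattice_point (I d) (J d + 1), lattice_point (I d) (J d), lattice_point (I d + 1) (J d)}
      \<inter> {p. 0 \<le> height p})"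
    by (rule triangle_Int_halfspace_not_quadrilateral[OF linear_height])
      (use False y_less[of d] in \<open>auto simp: height_square\<close>)
  with False show ?thesis by (simp add: low_def on_or_above_eq insert_commute)
qed

lemma up_quadrilateral_iff:
  assumes d: "0 < d" "d < c"
  shows "is_quadrilateral (cell_set (up d) \<inter> on_or_above (a, b)) \<longleftrightarrow> y d < b"
proof (cases "y d < b")
  case True
  have "is_quadrilateral (convex hull {lattice_point (I d + 1) (J d), lattice_point (I d + 1) (J d + 1), lattice_point (I d) (J d + 1)}
      \<inter> {p. 0 \<le> height p})"
    using True y_pos[OF d] y_less[of d]
    by (intro triangle_Int_halfspace_quadrilateral[OF linear_height _ _ _ linear_coordinates(1,3)])
      (simp_all only: height_square, simp_all add: lattice_point_def)
  with True show ?thesis by (simp add: up_def on_or_above_eq insert_commute)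
next
  case False
  have "\<not> is_quadrilateral (convex hull {lattice_point (I d) (J d + 1), lattice_point (I d + 1) (J d + 1), lattice_point (I d + 1) (J d)}
      \<inter> {p. 0 \<le> height p})"
    by (rule triangle_Int_halfspace_not_quadrilateral[OF linear_height])
      (use False y_less[of d] in \<open>auto simp: height_square\<close>)
  with False show ?thesis by (simp add: up_def on_or_above_eq insert_commute)
qed

lemma first_triangle_iff:
  assumes "x \<in> low ` {1..<c} \<union> up ` {1..<c}"
  shows "first_triangle (a, b) x \<longleftrightarrow> x = low 1"
proof
  have low1: "low 1 \<in> snake_triangles (a, b)" "low 1 \<in> set cells" "lo (low 1) \<le> 0"
    using c_gt square_bounds(6)[of 1] J_one
    by (auto simp: snake_triangles_eq set_cells lo_hi entry_def I_def)
  show "x = low 1" if "first_triangle (a, b) x"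
  proof (rule ccontr)
    assume "x \<noteq> low 1"
    then have "precedes (a, b) x (low 1)" using that low1 by (auto simp: first_triangle_def)
    moreover have x: "x \<in> set cells" using assms by (auto simp: set_cells)
    ultimately have "hi x \<le> 0" using precedes_cells_iff[OF x low1(2)] low1(3) by simp
    moreover have "0 < hi x"
      using assms
    proof (elim UnE imageE)
      fix d assume d: "d \<in> {1..<c}" "x = low d"
      then show ?thesis by (simp add: lo_hi)
    next
      fix d assume d: "d \<in> {1..<c}" "x = up d"
      then have "0 < d / c" "d / c < exit d" "hi x = exit d"
        using exit_greater[of d] by (auto simp: lo_hi)
      then show ?thesis by linarith
    qed
    ultimately show False by simp
  qed
  have "[1..<c - 1] = 1 # [Suc 1..<c - 1]" using c_gt by (intro upt_conv_Cons) simp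
  then have "\<exists>zs. cells = low 1 # zs" unfolding cells_def prefix_cells_def by simp
  then obtain zs where zs: "cells = low 1 # zs" ..
  show "first_triangle (a, b) x" if "x = low 1"
    unfolding first_triangle_def that
  proof (intro conjI ballI impI low1)
    fix z assume z: "z \<in> snake_triangles (a, b)" "z \<noteq> low 1"
    then have zc: "z \<in> set cells" by (auto simp: snake_triangles_eq set_cells)
    then have "before (low 1) z" using z sorted_cells unfolding zs by auto
    then show "precedes (a, b) (low 1) z"
      using precedes_cells_iff[OF low1(2) zc] by (simp add: before_def)
  qed
qed

lemma low_one_iff:
  assumes "0 < d" "d < c"
  shows "low d = low 1 \<longleftrightarrow> d = 1"
proof
  assume "low d = low 1"
  then have "hi (low d) = hi (low 1)" by simp
  then show "d = 1" using assms c_gt by (simp add: lo_hi)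
qed simp

text \<open>After a vertical side the residue exceeds \<open>a\<close>, after a horizontal one it is
  smaller. This ties the sign of a lower triangle to the kind of side through which it is
  entered.\<close>

lemma y_neq_a:
  assumes "0 < d" "Suc d < c"
  shows "y (Suc d) < a \<longleftrightarrow> b \<le> y d" "y (Suc d) \<noteq> a"
proof -
  have "0 < y d" "y d < a + b" using y_pos[of d] y_less[of d] assms by (auto simp: c_def)
  then have "(y (Suc d) < a \<longleftrightarrow> b \<le> y d) \<and> y (Suc d) \<noteq> a"
    using y_Suc_vertical[of d] y_Suc_horizontal[of d] by (cases "y d < b") auto
  then show "y (Suc d) < a \<longleftrightarrow> b \<le> y d" "y (Suc d) \<noteq> a" by auto
qed

text \<open>The origin is a corner of this triangle and lies on the line, so the part above is no
  quadrilateral; the sign is due to the rule for the first triangle.\<close>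

lemma cell_signs_low_one: "cell_signs k (a, b) (low 1) = [Minus]"
proof -
  have "first_triangle (a, b) (low 1)" using c_gt by (subst first_triangle_iff) (intro UnI1 imageI, auto)
  then show ?thesis by (simp add: low_def)
qed

lemma cell_signs_low_Suc:
  assumes d: "0 < d" "Suc d < c"
  shows "cell_signs k (a, b) (low (Suc d)) = [if y d < b then Plus else Minus]"
proof -
  have "low (Suc d) \<in> low ` {1..<c} \<union> up ` {1..<c}" by (intro UnI1 imageI) (use d in simp)
  from first_triangle_iff[OF this] have "\<not> first_triangle (a, b) (low (Suc d))"
    using low_one_iff[of "Suc d"] d by simp
  moreover have "is_quadrilateral (cell_set (low (Suc d)) \<inter> on_or_above (a, b)) \<longleftrightarrow> \<not> y d < b"
    using low_quadrilateral_iff[of "Suc d"] y_neq_a[OF d] d by auto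
  ultimately show ?thesis by (simp add: low_def)
qed

lemma cell_signs_up:
  assumes d: "0 < d" "d < c"
  shows "cell_signs k (a, b) (up d) = [if y d < b then Minus else Plus]"
proof -
  have tri: "up d \<in> low ` {1..<c} \<union> up ` {1..<c}" by (intro UnI2 imageI) (use d in simp)
  have "up d \<noteq> low 1"
  proof
    assume "up d = low 1"
    then have "lo (up d) = lo (low 1)" by simp
    moreover have "0 < d / c" using d by simp
    ultimately show False
      using d c_gt J_one by (auto simp: lo_hi entry_def I_def)
  qed
  then have "\<not> first_triangle (a, b) (up d)"
    using first_triangle_iff[OF tri] by simp
  then show ?thesis using up_quadrilateral_iff[OF d] by (simp add: up_def)
qed

lemma height_midpoint: "height (midpoint p q) = (height p + height q) / 2"
  by (simp add: midpoint_def linear_add[OF linear_height] linear_scale[OF linear_height])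

lemma cell_signs_dia:
  "cell_signs k (a, b) (dia d) = diagonal_signs Minus k a c d"
proof -
  have "0 \<le> height (midpoint (lattice_point (I d) (J d + 1)) (lattice_point (I d + 1) (J d))) \<longleftrightarrow> 2 * y d \<le> c"
    unfolding height_midpoint height_square by auto
  then show ?thesis
    by (auto simp: dia_def diagonal_signs_def side_sign_def on_or_above_eq y_def)
qed

lemma cell_signs_side:
  "cell_signs k (a, b) (side d) = replicate k (side_sign Minus c (y d + y (Suc d)))"
proof (cases "y d < b")
  case True
  have "0 \<le> height (midpoint (lattice_point (I d + 1) (J d)) (lattice_point (I d + 1) (J d + 1))) \<longleftrightarrow> y d + y (Suc d) \<le> c"
    unfolding height_midpoint height_square y_Suc_vertical[OF True] c_def by auto
  then show ?thesis using True by (auto simp: side_def side_sign_def on_or_above_eq)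
next
  case False
  have "0 \<le> height (midpoint (lattice_point (I d) (J d + 1)) (lattice_point (I d + 1) (J d + 1))) \<longleftrightarrow> y d + y (Suc d) \<le> c"
    using False y_Suc_horizontal[of d] unfolding height_midpoint height_square c_def by auto
  then show ?thesis using False by (auto simp: side_def side_sign_def on_or_above_eq)
qed

lemma crossing_signs_eq:
  assumes "0 < d" "Suc d < c"
  shows "cell_signs k (a, b) (up d) @ cell_signs k (a, b) (side d) @ cell_signs k (a, b) (low (Suc d)) =
    crossing_signs Minus k a c d"
proof -
  have "crossing_signs Minus k a c d = (let e = replicate k (side_sign Minus c (y d + y (Suc d)))
      in if y d < y (Suc d) then Minus # e @ [Plus] else Plus # e @ [Minus])"
    by (simp only: crossing_signs_def y_def)
  moreover have "y d < y (Suc d) \<longleftrightarrow> y d < b"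
    using y_Suc_vertical[of d] y_Suc_horizontal[of d] pos by (cases "y d < b") auto
  ultimately show ?thesis
    using assms by (simp add: cell_signs_up cell_signs_low_Suc cell_signs_side Let_def)
qed

lemma sign_sequence_eq: "sign_sequence k (a, b) = snake_word Minus k a c"
proof -
  let ?s = "cell_signs k (a, b)"
  define n where "n = c - 1"
  have "0 < n" "n < c" using c_gt unfolding n_def by linarith+
  moreover have "\<not> y n < b" unfolding n_def y_last by simp
  ultimately have n: "0 < n" "n < c" "\<not> y n < b" by blast+
  have "sign_sequence k (a, b) =
      (concat (map (\<lambda>d. ?s (low d) @ (?s (dia d) @ ?s (up d) @ ?s (side d))) [1..<n]) @ ?s (low n)) @ ?s (dia n) @ ?s (up n)"
  proof -
    have "concat (map ?s (concat (map (\<lambda>d. [low d, dia d, up d, side d]) ds))) =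
        concat (map (\<lambda>d. ?s (low d) @ (?s (dia d) @ ?s (up d) @ ?s (side d))) ds)" for ds
      by (induction ds) auto
    then show ?thesis
      unfolding sign_sequence_def passed_cells_eq cells_def n_def[symmetric] prefix_cells_def by simp
  qed
  \<comment> \<open>The cells come square by square. Bracketing from the other end groups them
    around the sides, as in \<open>inner_word\<close>, and sets the first triangle apart.\<close>
  also have "\<dots> = (?s (low 1) @ concat (map (\<lambda>d. (?s (dia d) @ ?s (up d) @ ?s (side d)) @ ?s (low (Suc d))) [1..<n]))
      @ ?s (dia n) @ ?s (up n)"
    by (subst concat_upt_shift[OF n(1)]) simp
  also have "map (\<lambda>d. (?s (dia d) @ ?s (up d) @ ?s (side d)) @ ?s (low (Suc d))) [1..<n] =
      map (\<lambda>d. diagonal_signs Minus k a c d @ crossing_signs Minus k a c d) [1..<n]"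
  proof (rule map_cong[OF refl])
    fix d assume "d \<in> set [1..<n]"
    then have "0 < d" "Suc d < c" by (auto simp: n_def)
    from crossing_signs_eq[OF this, of k]
    show "(?s (dia d) @ ?s (up d) @ ?s (side d)) @ ?s (low (Suc d)) =
        diagonal_signs Minus k a c d @ crossing_signs Minus k a c d"
      by (simp add: cell_signs_dia)
  qed
  finally show ?thesis
    using n cell_signs_low_one cell_signs_up[OF n(1,2)]
    unfolding snake_word_def inner_word_def n_def[symmetric] by (simp add: cell_signs_dia)
qed

end

theorem theorem7p26:
  fixes k a b :: nat
  assumes "0 < a" and "a < b" and "coprime a b"
  shows "cfrac_value (F_plus k (a, b)) = real (markov_number k (a, b)) / real (u_plus k (a, b))"
proof -
  interpret snake a b
    by unfold_locales (use assms in auto)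
  show ?thesis
    unfolding F_plus_def sign_sequence_eq c_def by (rule snake_word_cfrac[OF assms])
qed

end
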